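(* Let $G$ be a compact connected Lie group with Lie algebra $\mathfrak{g}$ and maximal torus $T$. Let $\gamma\in\Omega G$ be fixed by $T\times S^1$ and let $(t,e^{i\psi})\in T\times S^1$. After identifying $T_\gamma\Omega G\simeq\Omega\mathfrak{g}$, the isotropy representation of $T\times S^1$ on $T_\gamma\Omega G$ is given by $$(t,e^{i\psi})_*:\Omega\mathfrak{g}\to\Omega\mathfrak{g},\qquad X(\theta)\mapsto \mathrm{Ad}_{t\gamma(\psi)}\,X(\theta+\psi),$$ where the right-hand side is understood modulo constant loops under the identification $\Omega\mathfrak{g}\simeq L\mathfrak{g}/\mathfrak{g}$.
   Context: $\Omega G=\{\gamma\in C^\infty(S^1,G):\gamma(1)=e\}$ is the based loop group; loops are written as functions of the angle $\theta\in[0,2\pi)$. The torus $T\times S^1$ acts on $\Omega G$ by $(t\cdot\gamma)(\theta)=t\gamma(\theta)t^{-1}$ for $t\in T$ and $(e^{i\psi}\cdot\gamma)(\theta)=\gamma(\theta+\psi)\gamma(\psi)^{-1}$ for $e^{i\psi}\in S^1$; these commute. $L\mathfrak{g}=C^\infty(S^1,\mathfrak{g})$ and $\Omega\mathfrak{g}=\{X\in L\mathfrak{g}: X(0)=0\}$, which is identified with $L\mathfrak{g}/\mathfrak{g}$ (quotient by constant loops). The identification $T_\gamma\Omega G\simeq\Omega\mathfrak{g}$ is by left translation: a tangent vector $\delta\gamma$ at $\gamma$ corresponds to $X(\theta)=\gamma(\theta)^{-1}\delta\gamma(\theta)$. The isotropy representation at a fixed point $\gamma$ is the derivative at $\gamma$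 of the action map of each group element. *)

theory Defs
  imports "HOL-Analysis.Analysis" "HOL-Algebra.Product_Groups"
begin

section \<open>Smooth maps between subsets of Euclidean spaces\<close>

fun Ck_on :: "nat \<Rightarrow> 'a::real_normed_vector set \<Rightarrow> ('a \<Rightarrow> 'b::real_normed_vector) \<Rightarrow> bool" where
  "Ck_on 0 S f \<longleftrightarrow> continuous_on S f"
| "Ck_on (Suc k) S f \<longleftrightarrow> (\<forall>x\<in>S. f differentiable (at x)) \<and>
     (\<forall>v. Ck_on k S (\<lambda>x. frechet_derivative f (at x) v))"

text \<open>On an arbitrary subset, smooth means: locally the restriction of a smooth function on an open
  set. For open subsets this is the usual notion; for relatively open subsets of a linear subspace
  it is smoothness with respect to that subspace.\<close>

definition smooth_on :: "'a::euclidean_space set \<Rightarrow> ('a \<Rightarrow> 'b::euclidean_space) \<Rightarrow> bool" where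
  "smooth_on S f \<longleftrightarrow> (\<forall>x\<in>S. \<exists>W h. open W \<and> x \<in> W \<and> (\<forall>k. Ck_on k W h) \<and> (\<forall>y\<in>S \<inter> W. h y = f y))"


section \<open>Smooth manifolds\<close>

text \<open>Charts take values in a linear subspace \<open>model\<close> of a Euclidean space, so that every dimension,
  including zero, is covered (the type class itself forces positive dimension). The second
  component of a chart is only relevant on the first, its domain.\<close>

type_synonym ('p, 'e) chart = "'p set \<times> ('p \<Rightarrow> 'e)"

record ('p, 'e) mfd =
  mtop :: "'p topology"
  model :: "'e set"
  atlas :: "('p, 'e) chart set"

definition smooth_manifold :: "('p, 'e::euclidean_space) mfd \<Rightarrow> bool" where
  "smooth_manifold M \<longleftrightarrow>
     Hausdorff_space (mtop M) \<and> second_countable (mtop M) \<and> subspace (model M) \<and>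
     (\<Union>(U, \<phi>)\<in>atlas M. U) = topspace (mtop M) \<and>
     (\<forall>(U, \<phi>)\<in>atlas M. openin (mtop M) U \<and> openin (top_of_set (model M)) (\<phi> ` U) \<and>
        homeomorphic_map (subtopology (mtop M) U) (top_of_set (\<phi> ` U)) \<phi>) \<and>
     (\<forall>(U, \<phi>)\<in>atlas M. \<forall>(V, \<psi>)\<in>atlas M. smooth_on (\<phi> ` (U \<inter> V)) (\<psi> \<circ> inv_into U \<phi>))"

definition open_mfd :: "'a::euclidean_space set \<Rightarrow> ('a, 'a) mfd" where
  "open_mfd S = \<lparr>mtop = top_of_set S, model = UNIV, atlas = {(S, id)}\<rparr>"

definition prod_mfd :: "('p, 'e) mfd \<Rightarrow> ('q, 'f) mfd \<Rightarrow> ('p \<times> 'q, 'e \<times> 'f) mfd" where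
  "prod_mfd M N = \<lparr>mtop = prod_topology (mtop M) (mtop N), model = model M \<times> model N,
     atlas = {(U \<times> V, map_prod \<phi> \<psi>) | U \<phi> V \<psi>. (U, \<phi>) \<in> atlas M \<and> (V, \<psi>) \<in> atlas N}\<rparr>"

definition smooth_map ::
    "('p, 'e::euclidean_space) mfd \<Rightarrow> ('q, 'f::euclidean_space) mfd \<Rightarrow> ('p \<Rightarrow> 'q) \<Rightarrow> bool" where
  "smooth_map M N f \<longleftrightarrow> continuous_map (mtop M) (mtop N) f \<and>
     (\<forall>(U, \<phi>)\<in>atlas M. \<forall>(V, \<psi>)\<in>atlas N.
        smooth_on (\<phi> ` {x\<in>U. f x \<in> V}) (\<psi> \<circ> f \<circ> inv_into U \<phi>))"


section \<open>Tangent spaces\<close>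

text \<open>A tangent vector is the velocity of a smooth curve, encoded as the family of its coordinate
  vectors in all charts of the atlas around the base point (with value 0 at other arguments). Two
  curves through a point have the same velocity iff their derivatives agree in the charts there.
  The vector space operations on a tangent space are the pointwise operations on such families.\<close>

type_synonym ('p, 'e) tangent = "('p, 'e) chart \<Rightarrow> 'e"

definition velocity :: "('p, 'e::euclidean_space) mfd \<Rightarrow> (real \<Rightarrow> 'p) \<Rightarrow> ('p, 'e) tangent" where
  "velocity M c = (\<lambda>\<kappa>. if \<kappa> \<in> atlas M \<and> c 0 \<in> fst \<kappa>
                       then vector_derivative (snd \<kappa> \<circ> c) (at 0) else 0)"

definition smooth_curve_at :: "('p, 'e::euclidean_space) mfd \<Rightarrow> 'p \<Rightarrow> (real \<Rightarrow> 'p) \<Rightarrow> bool" where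
  "smooth_curve_at M p c \<longleftrightarrow> c 0 = p \<and> (\<exists>\<epsilon>>0. smooth_map (open_mfd {-\<epsilon><..<\<epsilon>}) M c)"

definition tangent_space :: "('p, 'e::euclidean_space) mfd \<Rightarrow> 'p \<Rightarrow> ('p, 'e) tangent set" where
  "tangent_space M p = velocity M ` {c. smooth_curve_at M p c}"

definition tangent_map ::
    "('p, 'e::euclidean_space) mfd \<Rightarrow> ('q, 'f::euclidean_space) mfd \<Rightarrow> ('p \<Rightarrow> 'q) \<Rightarrow> 'p
     \<Rightarrow> ('p, 'e) tangent \<Rightarrow> ('q, 'f) tangent" where
  "tangent_map M N f p v = velocity N (f \<circ> (SOME c. smooth_curve_at M p c \<and> velocity M c = v))"


section \<open>Lie groups and maximal tori\<close>

definition lie_group :: "('g, 'm) monoid_scheme \<Rightarrow> ('g, 'e::euclidean_space) mfd \<Rightarrow> bool" where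
  "lie_group G M \<longleftrightarrow> group G \<and> smooth_manifold M \<and> topspace (mtop M) = carrier G \<and>
     smooth_map (prod_mfd M M) M (\<lambda>(x, y). x \<otimes>\<^bsub>G\<^esub> y) \<and>
     smooth_map M M (\<lambda>x. inv\<^bsub>G\<^esub> x)"

definition lie_algebra ::
    "('g, 'm) monoid_scheme \<Rightarrow> ('g, 'e::euclidean_space) mfd \<Rightarrow> ('g, 'e) tangent set" where
  "lie_algebra G M = tangent_space M \<one>\<^bsub>G\<^esub>"

definition Ad :: "('g, 'm) monoid_scheme \<Rightarrow> ('g, 'e::euclidean_space) mfd \<Rightarrow> 'g
    \<Rightarrow> ('g, 'e) tangent \<Rightarrow> ('g, 'e) tangent" where
  "Ad G M g = tangent_map M M (\<lambda>x. g \<otimes>\<^bsub>G\<^esub> x \<otimes>\<^bsub>G\<^esub> inv\<^bsub>G\<^esub> g) \<one>\<^bsub>G\<^esub>"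

definition circle_group :: "complex monoid" where
  "circle_group = \<lparr>carrier = sphere 0 1, mult = (*), one = 1\<rparr>"

text \<open>A torus is a subgroup that is isomorphic, as a topological group, to a power of the circle
  group. For subgroups of a Lie group this agrees with isomorphy as Lie groups, since continuous
  homomorphisms between Lie groups are smooth.\<close>

definition torus_subgroup ::
    "('g, 'm) monoid_scheme \<Rightarrow> ('g, 'e) mfd \<Rightarrow> 'g set \<Rightarrow> bool" where
  "torus_subgroup G M T \<longleftrightarrow> subgroup T G \<and>
     (\<exists>(k::nat) h. h \<in> iso (product_group {..<k} (\<lambda>_. circle_group)) (G\<lparr>carrier := T\<rparr>) \<and>
        homeomorphic_map (product_topology (\<lambda>_. top_of_set (sphere (0::complex) 1)) {..<k})
          (subtopology (mtop M) T) h)"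

definition maximal_torus ::
    "('g, 'm) monoid_scheme \<Rightarrow> ('g, 'e) mfd \<Rightarrow> 'g set \<Rightarrow> bool" where
  "maximal_torus G M T \<longleftrightarrow> torus_subgroup G M T \<and>
     (\<forall>T'. torus_subgroup G M T' \<and> T \<subseteq> T' \<longrightarrow> T' = T)"


section \<open>The based loop group and its tangent spaces\<close>

text \<open>Loops are \<open>2\<pi>\<close>-periodic functions of the angle.\<close>

definition based_loops ::
    "('g, 'm) monoid_scheme \<Rightarrow> ('g, 'e::euclidean_space) mfd \<Rightarrow> (real \<Rightarrow> 'g) set" where
  "based_loops G M = {\<gamma>. smooth_map (open_mfd UNIV) M \<gamma> \<and> (\<forall>\<theta>. \<gamma> (\<theta> + 2 * pi) = \<gamma> \<theta>) \<and>
     \<gamma> 0 = \<one>\<^bsub>G\<^esub>}"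

text \<open>Smoothness of a curve in the Frechet manifold of loops is joint smoothness in the curve
  parameter and the angle.\<close>

definition loop_curve_at :: "('g, 'm) monoid_scheme \<Rightarrow> ('g, 'e::euclidean_space) mfd
    \<Rightarrow> (real \<Rightarrow> 'g) \<Rightarrow> (real \<Rightarrow> real \<Rightarrow> 'g) \<Rightarrow> bool" where
  "loop_curve_at G M \<gamma> c \<longleftrightarrow> c 0 = \<gamma> \<and>
     (\<exists>\<epsilon>>0. (\<forall>s\<in>{-\<epsilon><..<\<epsilon>}. c s \<in> based_loops G M) \<and>
        smooth_map (open_mfd ({-\<epsilon><..<\<epsilon>} \<times> UNIV)) M (\<lambda>(s, \<theta>). c s \<theta>))"

definition loop_velocity :: "('g, 'e::euclidean_space) mfd \<Rightarrow> (real \<Rightarrow> real \<Rightarrow> 'g)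
    \<Rightarrow> real \<Rightarrow> ('g, 'e) tangent" where
  "loop_velocity M c = (\<lambda>\<theta>. velocity M (\<lambda>s. c s \<theta>))"

definition loop_tangent_space :: "('g, 'm) monoid_scheme \<Rightarrow> ('g, 'e::euclidean_space) mfd
    \<Rightarrow> (real \<Rightarrow> 'g) \<Rightarrow> (real \<Rightarrow> ('g, 'e) tangent) set" where
  "loop_tangent_space G M \<gamma> = loop_velocity M ` {c. loop_curve_at G M \<gamma> c}"

definition loop_tangent_map :: "('g, 'm) monoid_scheme \<Rightarrow> ('g, 'e::euclidean_space) mfd
    \<Rightarrow> ((real \<Rightarrow> 'g) \<Rightarrow> (real \<Rightarrow> 'g)) \<Rightarrow> (real \<Rightarrow> 'g)
    \<Rightarrow> (real \<Rightarrow> ('g, 'e) tangent) \<Rightarrow> (real \<Rightarrow> ('g, 'e) tangent)" where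
  "loop_tangent_map G M F \<gamma> \<delta> =
     loop_velocity M (F \<circ> (SOME c. loop_curve_at G M \<gamma> c \<and> loop_velocity M c = \<delta>))"

text \<open>The map \<open>F\<close> sends smooth curves through \<open>\<gamma>\<close> to smooth curves, and the velocity of the image
  curve only depends on the velocity of the given one, so that the choice in
  \<open>loop_tangent_map\<close> is immaterial.\<close>

definition loop_differentiable_at :: "('g, 'm) monoid_scheme \<Rightarrow> ('g, 'e::euclidean_space) mfd
    \<Rightarrow> ((real \<Rightarrow> 'g) \<Rightarrow> (real \<Rightarrow> 'g)) \<Rightarrow> (real \<Rightarrow> 'g) \<Rightarrow> bool" where
  "loop_differentiable_at G M F \<gamma> \<longleftrightarrow> (\<forall>c. loop_curve_at G M \<gamma> c \<longrightarrow>
     loop_curve_at G M (F \<gamma>) (F \<circ> c) \<and>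
     loop_velocity M (F \<circ> c) = loop_tangent_map G M F \<gamma> (loop_velocity M c))"


section \<open>Loops in the Lie algebra\<close>

definition algebra_loops :: "('g, 'm) monoid_scheme \<Rightarrow> ('g, 'e::euclidean_space) mfd
    \<Rightarrow> (real \<Rightarrow> ('g, 'e) tangent) set" where
  "algebra_loops G M = {X. (\<forall>\<theta>. X \<theta> \<in> lie_algebra G M) \<and> (\<forall>\<theta>. X (\<theta> + 2 * pi) = X \<theta>) \<and>
     (\<forall>\<kappa>. smooth_on UNIV (\<lambda>\<theta>. X \<theta> \<kappa>))}"

definition based_algebra_loops :: "('g, 'm) monoid_scheme \<Rightarrow> ('g, 'e::euclidean_space) mfd
    \<Rightarrow> (real \<Rightarrow> ('g, 'e) tangent) set" where
  "based_algebra_loops G M = {X \<in> algebra_loops G M. X 0 = (\<lambda>_. 0)}"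

text \<open>The class of \<open>X\<close> in the quotient of the loop algebra by the constant loops.\<close>

definition mod_constants :: "('g, 'm) monoid_scheme \<Rightarrow> ('g, 'e::euclidean_space) mfd
    \<Rightarrow> (real \<Rightarrow> ('g, 'e) tangent) \<Rightarrow> (real \<Rightarrow> ('g, 'e) tangent) set" where
  "mod_constants G M X =
     {Y \<in> algebra_loops G M. \<exists>a\<in>lie_algebra G M. \<forall>\<theta>. Y \<theta> = (\<lambda>\<kappa>. X \<theta> \<kappa> + a \<kappa>)}"

text \<open>Left trivialisation of the tangent space at \<open>\<gamma>\<close>: the loop \<open>\<theta> \<mapsto> \<gamma>(\<theta>)\<^sup>-\<^sup>1 \<delta>(\<theta>)\<close>.\<close>

definition left_triv :: "('g, 'm) monoid_scheme \<Rightarrow> ('g, 'e::euclidean_space) mfd \<Rightarrow> (real \<Rightarrow> 'g)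
    \<Rightarrow> (real \<Rightarrow> ('g, 'e) tangent) \<Rightarrow> (real \<Rightarrow> ('g, 'e) tangent)" where
  "left_triv G M \<gamma> \<delta> =
     (\<lambda>\<theta>. tangent_map M M (\<lambda>x. inv\<^bsub>G\<^esub> (\<gamma> \<theta>) \<otimes>\<^bsub>G\<^esub> x) (\<gamma> \<theta>) (\<delta> \<theta>))"


section \<open>The action of \<open>T \<times> S\<^sup>1\<close> and the isotropy representation\<close>

definition conj_action :: "('g, 'm) monoid_scheme \<Rightarrow> 'g \<Rightarrow> (real \<Rightarrow> 'g) \<Rightarrow> (real \<Rightarrow> 'g)" where
  "conj_action G t \<gamma> = (\<lambda>\<theta>. t \<otimes>\<^bsub>G\<^esub> \<gamma> \<theta> \<otimes>\<^bsub>G\<^esub> inv\<^bsub>G\<^esub> t)"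

definition rot_action :: "('g, 'm) monoid_scheme \<Rightarrow> real \<Rightarrow> (real \<Rightarrow> 'g) \<Rightarrow> (real \<Rightarrow> 'g)" where
  "rot_action G \<psi> \<gamma> = (\<lambda>\<theta>. \<gamma> (\<theta> + \<psi>) \<otimes>\<^bsub>G\<^esub> inv\<^bsub>G\<^esub> (\<gamma> \<psi>))"

text \<open>The group element \<open>(t, exp(i \<psi>))\<close> is given by \<open>t\<close> and an arbitrary real angle \<open>\<psi>\<close>; on periodic
  loops its action depends on \<open>\<psi>\<close> only modulo \<open>2\<pi>\<close>.\<close>

definition torus_action ::
    "('g, 'm) monoid_scheme \<Rightarrow> 'g \<Rightarrow> real \<Rightarrow> (real \<Rightarrow> 'g) \<Rightarrow> (real \<Rightarrow> 'g)" where
  "torus_action G t \<psi> = conj_action G t \<circ> rot_action G \<psi>"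

definition fixed_loop :: "('g, 'm) monoid_scheme \<Rightarrow> 'g set \<Rightarrow> (real \<Rightarrow> 'g) \<Rightarrow> bool" where
  "fixed_loop G T \<gamma> \<longleftrightarrow> (\<forall>t\<in>T. \<forall>\<psi>. torus_action G t \<psi> \<gamma> = \<gamma>)"

text \<open>The derivative of the action at a fixed point \<open>\<gamma>\<close>, transported by the left trivialisation.\<close>

definition isotropy_rep :: "('g, 'm) monoid_scheme \<Rightarrow> ('g, 'e::euclidean_space) mfd
    \<Rightarrow> (real \<Rightarrow> 'g) \<Rightarrow> 'g \<Rightarrow> real
    \<Rightarrow> (real \<Rightarrow> ('g, 'e) tangent) \<Rightarrow> (real \<Rightarrow> ('g, 'e) tangent)" where
  "isotropy_rep G M \<gamma> t \<psi> X =
     left_triv G M \<gamma> (loop_tangent_map G M (torus_action G t \<psi>) \<gamma>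
       (inv_into (loop_tangent_space G M \<gamma>) (left_triv G M \<gamma>) X))"

end

theory Submission
  imports Defs
begin

text \<open>A curve \<open>c\<close> of loops through a fixed loop \<open>\<gamma>\<close> is moved by \<open>(t, exp(i \<psi>))\<close> to
  \<open>t c(\<theta> + \<psi>) c(\<psi>)\<^sup>-\<^sup>1 t\<^sup>-\<^sup>1\<close>. Since \<open>\<gamma>\<close> is fixed, \<open>\<gamma>(\<theta>)\<^sup>-\<^sup>1 = t \<gamma>(\<psi>) \<gamma>(\<theta> + \<psi>)\<^sup>-\<^sup>1 t\<^sup>-\<^sup>1\<close>, so the
  left translate of the moved curve is a conjugate by \<open>t \<gamma>(\<psi>)\<close> of the left translate of \<open>c\<close> at
  \<open>\<theta> + \<psi>\<close> times a curve in \<open>G\<close> that does not depend on \<open>\<theta>\<close>. By the product rule at the identity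
  the velocity is \<open>Ad X(\<theta> + \<psi>)\<close> plus a constant of the Lie algebra.\<close>

section \<open>Calculus of smooth maps\<close>

text \<open>\<open>isotropy_rep\<close> hides three choices: \<open>inv_into\<close> of the left
  trivialisation, the representing curve in \<open>loop_tangent_map\<close>, and the one in
  \<open>tangent_map\<close>. A computation with one curve means something only after each is shown
  harmless, and most of the work goes there: velocities of images must depend on velocities alone,
  and \<open>left_triv\<close> must be a bijection onto the based algebra loops. The loop space
  carries no charts. A curve of loops is a jointly smooth family, so claims about it are reduced to
  curves in \<open>G\<close> at a single angle, and smoothness in the angle is recovered from joint
  smoothness. Addition and negation in the Lie algebra are realised by multiplying and inverting
  curves through \<open>\<one>\<close>. The constant separating the two sides is minus the adjoint
  image of \<open>X \<psi>\<close>: exactly what makes the result vanish at angle 0, as a member of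
  \<open>based_algebra_loops\<close> must.\<close>

lemma Ck_on_cong:
  assumes "open S" "\<And>x. x \<in> S \<Longrightarrow> f x = g x" "Ck_on k S f"
  shows "Ck_on k S g"
  using assms(2,3)
proof (induction k arbitrary: f g)
  case 0
  then show ?case by (simp cong: continuous_on_cong)
next
  case (Suc k)
  have *: "g differentiable (at x)" "frechet_derivative g (at x) = frechet_derivative f (at x)"
    if x: "x \<in> S" for x
  proof -
    have "(f has_derivative frechet_derivative f (at x)) (at x)"
      using Suc.prems(2) x frechet_derivative_works by auto
    \<comment> \<open>The derivative at a point looks at a full neighbourhood; openness of
      \<open>S\<close> supplies one on which \<open>f\<close> and \<open>g\<close> agree.\<close>
    then have D: "(g has_derivative frechet_derivative f (at x)) (at x)"
      by (rule has_derivative_transform_within_open[OF _ assms(1) x]) (use Suc.prems(1) in auto)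
    then show "g differentiable (at x)" by (auto simp: differentiable_def)
    show "frechet_derivative g (at x) = frechet_derivative f (at x)"
      using frechet_derivative_at[OF D] by simp
  qed
  have "Ck_on k S (\<lambda>x. frechet_derivative g (at x) v)" for v
    by (rule Suc.IH[of "\<lambda>x. frechet_derivative f (at x) v"]) (use * Suc.prems(2) in auto)
  then show ?case using * by simp
qed

text \<open>Replaces the chosen \<open>frechet_derivative\<close> by any explicit derivative
  \<open>D\<close>, so that each closure property below follows from the corresponding
  differentiation rule.\<close>

lemma Ck_on_SucI:
  assumes "open S" "\<And>x. x \<in> S \<Longrightarrow> (f has_derivative D x) (at x)"
    and "\<And>v. Ck_on k S (\<lambda>x. D x v)"
  shows "Ck_on (Suc k) S f"
proof -
  have *: "D x = frechet_derivative f (at x)" if "x \<in> S" for x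
    using frechet_derivative_at assms(2) that by blast
  have "Ck_on k S (\<lambda>x. frechet_derivative f (at x) v)" for v
    by (rule Ck_on_cong[OF assms(1) _ assms(3)[of v]]) (simp add: *)
  then show ?thesis using assms(2) by (auto simp: differentiable_def)
qed

lemma Ck_on_SucD:
  assumes "Ck_on (Suc k) S f"
  shows "\<And>x. x \<in> S \<Longrightarrow> (f has_derivative frechet_derivative f (at x)) (at x)"
    and "\<And>v. Ck_on k S (\<lambda>x. frechet_derivative f (at x) v)"
  using assms by (simp_all add: frechet_derivative_works)

text \<open>The recursion speaks only of directional derivatives, so monotonicity in the order is
  itself an induction, started by differentiability implying continuity.\<close>

lemma Ck_on_Suc_imp: "Ck_on (Suc k) S f \<Longrightarrow> Ck_on k S f"
proof (induction k arbitrary: f)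
  case 0
  then show ?case
    by (simp add: continuous_at_imp_continuous_on differentiable_imp_continuous_within)
next
  case (Suc k)
  have "Ck_on k S (\<lambda>x. frechet_derivative f (at x) v)" for v
    by (rule Suc.IH) (use Suc.prems in simp)
  then show ?case using Suc.prems by simp
qed

lemma Ck_on_subset:
  assumes "Ck_on k S f" "S' \<subseteq> S" shows "Ck_on k S' f"
  using assms(1)
proof (induction k arbitrary: f)
  case 0
  then show ?case using assms(2) continuous_on_subset by auto
next
  case (Suc k)
  have "Ck_on k S' (\<lambda>x. frechet_derivative f (at x) v)" for v
    using Suc.prems by (intro Suc.IH) simp
  then show ?case using Suc.prems assms(2) by auto
qed

lemma Ck_on_const: "open S \<Longrightarrow> Ck_on k S (\<lambda>x. c)"
proof (induction k arbitrary: c)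
  case (Suc k)
  show ?case by (rule Ck_on_SucI[OF Suc.prems has_derivative_const Suc.IH[OF Suc.prems]])
qed simp

lemma Ck_on_bounded_linear:
  assumes "open S" "bounded_linear L" shows "Ck_on k S L"
proof (cases k)
  case 0
  then show ?thesis using assms(2) by (simp add: linear_continuous_on)
next
  case (Suc n)
  show ?thesis unfolding Suc
    by (rule Ck_on_SucI[OF assms(1) bounded_linear_imp_has_derivative[OF assms(2)]
        Ck_on_const[OF assms(1)]])
qed

lemma Ck_on_add:
  assumes "open S" "Ck_on k S f" "Ck_on k S g"
  shows "Ck_on k S (\<lambda>x. f x + g x)"
  using assms(2,3)
proof (induction k arbitrary: f g)
  case 0
  then show ?case by (auto intro: continuous_intros)
next
  case (Suc k)
  show ?case
    by (rule Ck_on_SucI[OF assms(1) has_derivative_add[OF Ck_on_SucD(1)[OF Suc.prems(1)]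
          Ck_on_SucD(1)[OF Suc.prems(2)]]
        Suc.IH[OF Ck_on_SucD(2)[OF Suc.prems(1)] Ck_on_SucD(2)[OF Suc.prems(2)]]])
qed

text \<open>Each summand of the product rule keeps one factor undifferentiated; that factor must be
  lowered by one order before the induction hypothesis applies.\<close>

lemma Ck_on_scaleR:
  assumes "open S" "Ck_on k S r" "Ck_on k S f"
  shows "Ck_on k S (\<lambda>x. r x *\<^sub>R f x)"
  using assms(2,3)
proof (induction k arbitrary: r f)
  case 0
  then show ?case by (auto intro: continuous_intros)
next
  case (Suc k)
  show ?case
    by (rule Ck_on_SucI[OF assms(1) has_derivative_scaleR[OF Ck_on_SucD(1)[OF Suc.prems(1)]
          Ck_on_SucD(1)[OF Suc.prems(2)]]
        Ck_on_add[OF assms(1)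
          Suc.IH[OF Ck_on_Suc_imp[OF Suc.prems(1)] Ck_on_SucD(2)[OF Suc.prems(2)]]
          Suc.IH[OF Ck_on_SucD(2)[OF Suc.prems(1)] Ck_on_Suc_imp[OF Suc.prems(2)]]]])
qed

lemma Ck_on_sum:
  assumes "open S" "\<And>i. i \<in> I \<Longrightarrow> Ck_on k S (f i)"
  shows "Ck_on k S (\<lambda>x. \<Sum>i\<in>I. f i x)"
  using assms(2)
  by (induction I rule: infinite_finite_induct) (auto intro: Ck_on_const Ck_on_add assms(1))

lemma Ck_on_linear_comp:
  assumes "open S" "bounded_linear L" "Ck_on k S f"
  shows "Ck_on k S (\<lambda>x. L (f x))"
  using assms(3)
proof (induction k arbitrary: f)
  case 0
  then show ?case using assms(2) by (auto intro: bounded_linear.continuous_on)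
next
  case (Suc k)
  show ?case
    by (rule Ck_on_SucI[OF assms(1) bounded_linear.has_derivative[OF assms(2)
          Ck_on_SucD(1)[OF Suc.prems]] Suc.IH[OF Ck_on_SucD(2)[OF Suc.prems]]])
qed

lemma Ck_on_Pair:
  assumes "open S" "Ck_on k S f" "Ck_on k S g"
  shows "Ck_on k S (\<lambda>x. (f x, g x))"
  using assms(2,3)
proof (induction k arbitrary: f g)
  case 0
  then show ?case by (auto intro: continuous_intros)
next
  case (Suc k)
  show ?case
    by (rule Ck_on_SucI[OF assms(1) has_derivative_Pair[OF Ck_on_SucD(1)[OF Suc.prems(1)]
          Ck_on_SucD(1)[OF Suc.prems(2)]]
        Suc.IH[OF Ck_on_SucD(2)[OF Suc.prems(1)] Ck_on_SucD(2)[OF Suc.prems(2)]]])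
qed

text \<open>The chain rule differentiates \<open>g\<close> in a direction that varies with the
  point, while \<open>Ck_on\<close> controls only fixed directions. Expanding the direction over
  \<open>Basis\<close> gives a finite sum of products of scalar coefficients with derivatives of
  \<open>g\<close> in fixed directions.\<close>

lemma Ck_on_compose:
  fixes f :: "'a::real_normed_vector \<Rightarrow> 'b::euclidean_space" and g :: "'b \<Rightarrow> 'c::real_normed_vector"
  assumes "open S" "f ` S \<subseteq> R" "Ck_on k S f" "Ck_on k R g"
  shows "Ck_on k S (\<lambda>x. g (f x))"
  using assms(3,4)
proof (induction k arbitrary: g)
  case 0
  then show ?case using assms(2) by (auto intro: continuous_on_compose2)
next
  case (Suc k)
  let ?f' = "\<lambda>x. frechet_derivative f (at x)"
  let ?g' = "\<lambda>x. frechet_derivative g (at x)"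
  have D: "((\<lambda>x. g (f x)) has_derivative (\<lambda>v. ?g' (f x) (?f' x v))) (at x)" if "x \<in> S" for x
    using diff_chain_at[OF Ck_on_SucD(1)[OF Suc.prems(1) that] Ck_on_SucD(1)[OF Suc.prems(2)]] assms(2) that
    by (auto simp: o_def)
  have eq: "(\<Sum>b\<in>Basis. (?f' x v \<bullet> b) *\<^sub>R ?g' (f x) b) = ?g' (f x) (?f' x v)" if "x \<in> S" for x v
  proof -
    have "linear (?g' (f x))"
      using Ck_on_SucD(1)[OF Suc.prems(2)] assms(2) that
      by (meson bounded_linear.linear has_derivative_bounded_linear image_subset_iff)
    then have "(\<Sum>b\<in>Basis. (?f' x v \<bullet> b) *\<^sub>R ?g' (f x) b)
        = ?g' (f x) (\<Sum>b\<in>Basis. (?f' x v \<bullet> b) *\<^sub>R b)"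
      by (simp add: linear_sum linear_scale)
    then show ?thesis by (simp add: euclidean_representation)
  qed
  have "Ck_on k S (\<lambda>x. \<Sum>b\<in>Basis. (?f' x v \<bullet> b) *\<^sub>R ?g' (f x) b)" for v
  proof (intro Ck_on_sum Ck_on_scaleR assms(1))
    fix b :: 'b
    show "Ck_on k S (\<lambda>x. ?f' x v \<bullet> b)"
      by (rule Ck_on_linear_comp[OF assms(1) bounded_linear_inner_left Ck_on_SucD(2)[OF Suc.prems(1)]])
    show "Ck_on k S (\<lambda>x. ?g' (f x) b)"
      by (rule Suc.IH[OF Ck_on_Suc_imp[OF Suc.prems(1)] Ck_on_SucD(2)[OF Suc.prems(2)]])
  qed
  then have "Ck_on k S (\<lambda>x. ?g' (f x) (?f' x v))" for v
    by (rule Ck_on_cong[OF assms(1), rotated]) (use eq in simp)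
  then show ?case using D by (intro Ck_on_SucI[OF assms(1)])
qed

section \<open>Smoothness on arbitrary subsets, through local extensions\<close>

lemma smooth_onE:
  assumes "smooth_on S f" "x \<in> S"
  obtains W h where "open W" "x \<in> W" "\<forall>k. Ck_on k W h" "\<forall>y. y \<in> S \<longrightarrow> y \<in> W \<longrightarrow> h y = f y"
proof -
  have "\<exists>W h. open W \<and> x \<in> W \<and> (\<forall>k. Ck_on k W h) \<and> (\<forall>y\<in>S \<inter> W. h y = f y)"
    using assms by (simp add: smooth_on_def)
  then show thesis using that by (elim exE conjE) auto
qed

lemma smooth_on_subset:
  assumes "smooth_on S f" "S' \<subseteq> S" shows "smooth_on S' f"
  unfolding smooth_on_def
proof
  fix x assume "x \<in> S'"
  then have "x \<in> S" using assms(2) by auto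
  then obtain W h where "open W" "x \<in> W" "\<forall>k. Ck_on k W h"
    "\<forall>y. y \<in> S \<longrightarrow> y \<in> W \<longrightarrow> h y = f y"
    by (rule smooth_onE[OF assms(1)])
  then show "\<exists>W h. open W \<and> x \<in> W \<and> (\<forall>k. Ck_on k W h) \<and> (\<forall>y\<in>S' \<inter> W. h y = f y)"
    using assms(2) by (intro exI[of _ W] exI[of _ h]) auto
qed

lemma smooth_on_cong:
  assumes "smooth_on S f" "\<And>x. x \<in> S \<Longrightarrow> f x = g x" shows "smooth_on S g"
proof -
  have "(\<forall>y\<in>S \<inter> W. h y = f y) \<longleftrightarrow> (\<forall>y\<in>S \<inter> W. h y = g y)" for W and h :: "'a \<Rightarrow> 'b"
    using assms(2) by auto
  then show ?thesis using assms(1) by (simp add: smooth_on_def)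
qed

text \<open>Allows a different intermediate chart around each point when smooth maps between
  manifolds are composed.\<close>

lemma smooth_on_local:
  assumes "\<And>x. x \<in> S \<Longrightarrow> \<exists>W. open W \<and> x \<in> W \<and> smooth_on (S \<inter> W) f"
  shows "smooth_on S f"
  unfolding smooth_on_def
proof
  fix x assume "x \<in> S"
  then obtain W where W: "open W" "x \<in> W" "smooth_on (S \<inter> W) f" using assms by blast
  have "x \<in> S \<inter> W" using \<open>x \<in> S\<close> W(2) by simp
  then obtain V h where V: "open V" "x \<in> V" "\<forall>k. Ck_on k V h"
      "\<forall>y. y \<in> S \<inter> W \<longrightarrow> y \<in> V \<longrightarrow> h y = f y"
    by (rule smooth_onE[OF W(3)])
  then show "\<exists>W h. open W \<and> x \<in> W \<and> (\<forall>k. Ck_on k W h) \<and> (\<forall>y\<in>S \<inter> W. h y = f y)"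
    using W by (intro exI[of _ "W \<inter> V"] exI[of _ h]) (auto intro: Ck_on_subset[OF V(3)[rule_format]])
qed

lemma Ck_imp_smooth_on: "open S \<Longrightarrow> (\<And>k. Ck_on k S f) \<Longrightarrow> smooth_on S f"
  unfolding smooth_on_def by blast

lemma smooth_on_imp_Ck:
  assumes "open S" "smooth_on S f" shows "Ck_on k S f"
proof -
  have loc: "\<exists>W. open W \<and> x \<in> W \<and> W \<subseteq> S \<and> (\<forall>k. Ck_on k W f)" if x: "x \<in> S" for x
  proof -
    obtain W h where W: "open W" "x \<in> W" "\<forall>k. Ck_on k W h"
      "\<forall>y. y \<in> S \<longrightarrow> y \<in> W \<longrightarrow> h y = f y" by (rule smooth_onE[OF assms(2) x])
    have "Ck_on k (W \<inter> S) f" for k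
      by (rule Ck_on_cong[OF open_Int[OF W(1) assms(1)] _ Ck_on_subset[OF W(3)[rule_format]]])
        (auto simp: W(4)[rule_format])
    with W assms(1) x show ?thesis by (intro exI[of _ "W \<inter> S"]) auto
  qed
  \<comment> \<open>Locality of \<open>Ck_on\<close> is proved for every function, since the
    induction passes from a function to its directional derivatives.\<close>
  have "Ck_on k S f" if "\<And>x. x \<in> S \<Longrightarrow> \<exists>W. open W \<and> x \<in> W \<and> Ck_on k W f" for f :: "'a \<Rightarrow> 'b" and k
    using that
  proof (induction k arbitrary: f)
    case 0
    then have "continuous (at x) f" if "x \<in> S" for x
      using that by (metis Ck_on.simps(1) continuous_on_eq_continuous_at)
    then show ?case by (simp add: continuous_at_imp_continuous_on)
  next
    case (Suc k)
    have "f differentiable (at x)" if "x \<in> S" for x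
      using Suc.prems[OF that] by auto
    moreover have "Ck_on k S (\<lambda>x. frechet_derivative f (at x) v)" for v
      by (rule Suc.IH) (use Suc.prems in fastforce)
    ultimately show ?case by simp
  qed
  from this[of k f] show ?thesis using loc by blast
qed

lemma smooth_on_const: "smooth_on S (\<lambda>x. c)"
  by (rule smooth_on_subset[OF Ck_imp_smooth_on[OF open_UNIV Ck_on_const]]) auto

lemma smooth_on_bounded_linear: "bounded_linear L \<Longrightarrow> smooth_on S L"
  by (rule smooth_on_subset[OF Ck_imp_smooth_on[OF open_UNIV Ck_on_bounded_linear]]) auto

lemma smooth_on_id: "smooth_on S (\<lambda>x. x)"
  by (rule smooth_on_bounded_linear[OF bounded_linear_ident])

lemma smooth_on_Pair:
  assumes "smooth_on S f" "smooth_on S g" shows "smooth_on S (\<lambda>x. (f x, g x))"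
  unfolding smooth_on_def
proof
  fix x assume x: "x \<in> S"
  obtain W h where W: "open W" "x \<in> W" "\<forall>k. Ck_on k W h" "\<forall>y. y \<in> S \<longrightarrow> y \<in> W \<longrightarrow> h y = f y"
    by (rule smooth_onE[OF assms(1) x])
  obtain W' h' where W': "open W'" "x \<in> W'" "\<forall>k. Ck_on k W' h'" "\<forall>y. y \<in> S \<longrightarrow> y \<in> W' \<longrightarrow> h' y = g y"
    by (rule smooth_onE[OF assms(2) x])
  show "\<exists>W h. open W \<and> x \<in> W \<and> (\<forall>k. Ck_on k W h) \<and> (\<forall>y\<in>S \<inter> W. h y = (f y, g y))"
  proof (intro exI conjI allI ballI)
    show O: "open (W \<inter> W')" using W(1) W'(1) by (rule open_Int)
    show "x \<in> W \<inter> W'" using W(2) W'(2) by simp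
    show "Ck_on k (W \<inter> W') (\<lambda>x. (h x, h' x))" for k
      by (rule Ck_on_Pair[OF O Ck_on_subset[OF W(3)[rule_format]] Ck_on_subset[OF W'(3)[rule_format]]]) auto
    show "(h y, h' y) = (f y, g y)" if "y \<in> S \<inter> (W \<inter> W')" for y
      using that W(4)[rule_format] W'(4)[rule_format] by simp
  qed
qed

lemma smooth_on_compose:
  assumes "smooth_on S f" "smooth_on R g" "f ` S \<subseteq> R" shows "smooth_on S (\<lambda>x. g (f x))"
  unfolding smooth_on_def
proof
  fix x assume x: "x \<in> S"
  obtain W h where W: "open W" "x \<in> W" "\<forall>k. Ck_on k W h" "\<forall>y. y \<in> S \<longrightarrow> y \<in> W \<longrightarrow> h y = f y"
    by (rule smooth_onE[OF assms(1) x])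
  have "f x \<in> R" using x assms(3) by auto
  then obtain W' h' where W': "open W'" "f x \<in> W'" "\<forall>k. Ck_on k W' h'"
      "\<forall>y. y \<in> R \<longrightarrow> y \<in> W' \<longrightarrow> h' y = g y"
    by (rule smooth_onE[OF assms(2)])
  have "continuous_on W h" using W(3)[rule_format, of 0] by simp
  \<comment> \<open>The preimage is taken under the extension \<open>h\<close>, not under
    \<open>f\<close>: only \<open>h\<close> is known to be continuous on an open set.\<close>
  then have O: "open (h -` W' \<inter> W)" using W(1) W'(1) by (simp add: continuous_on_open_vimage)
  show "\<exists>W h. open W \<and> x \<in> W \<and> (\<forall>k. Ck_on k W h) \<and> (\<forall>y\<in>S \<inter> W. h y = g (f y))"
  proof (intro exI conjI allI ballI)
    show "open (h -` W' \<inter> W)" by (rule O)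
    show "x \<in> h -` W' \<inter> W" using W(2) W(4)[rule_format, OF x W(2)] W'(2) by auto
    show "Ck_on k (h -` W' \<inter> W) (\<lambda>x. h' (h x))" for k
      by (rule Ck_on_compose[OF O _ Ck_on_subset[OF W(3)[rule_format]] W'(3)[rule_format]]) auto
    show "h' (h y) = g (f y)" if "y \<in> S \<inter> (h -` W' \<inter> W)" for y
      using that W(4)[rule_format] W'(4)[rule_format] assms(3) by fastforce
  qed
qed

text \<open>Addition is a smooth map on the product space, so pairing and composition already
  provide the local extensions; scaling is treated the same way.\<close>

lemma smooth_on_add:
  assumes "smooth_on S f" "smooth_on S g" shows "smooth_on S (\<lambda>x. f x + g x)"
proof -
  have "smooth_on UNIV (\<lambda>z :: 'b \<times> 'b. fst z + snd z)"
    by (intro smooth_on_bounded_linear bounded_linear_intros)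
  from smooth_on_compose[OF smooth_on_Pair[OF assms] this] show ?thesis by simp
qed

lemma smooth_on_scaleR:
  assumes "smooth_on S r" "smooth_on S f" shows "smooth_on S (\<lambda>x. r x *\<^sub>R f x)"
proof -
  have "smooth_on UNIV (\<lambda>z :: real \<times> 'b. fst z *\<^sub>R snd z)"
    by (intro Ck_imp_smooth_on Ck_on_scaleR Ck_on_bounded_linear open_UNIV bounded_linear_fst bounded_linear_snd)
  from smooth_on_compose[OF smooth_on_Pair[OF assms] this] show ?thesis by simp
qed

lemma smooth_on_imp_continuous_on:
  assumes "smooth_on S f" shows "continuous_on S f"
  unfolding continuous_on_eq_continuous_within
proof
  fix x assume x: "x \<in> S"
  obtain W h where W: "open W" "x \<in> W" "\<forall>k. Ck_on k W h" "\<forall>y. y \<in> S \<longrightarrow> y \<in> W \<longrightarrow> h y = f y"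
    by (rule smooth_onE[OF assms x])
  have "continuous (at x) h" using W(1,2) W(3)[rule_format, of 0] by (simp add: continuous_on_eq_continuous_at)
  then have "(h \<longlongrightarrow> h x) (at x within S)"
    using continuous_at_imp_continuous_at_within continuous_within by blast
  moreover have "\<forall>\<^sub>F y in at x within S. h y = f y"
    unfolding eventually_at_topological using W by blast
  moreover have "h x = f x" using W(2,4) x by blast
  ultimately show "continuous (at x within S) f"
    unfolding continuous_within by (metis Lim_transform_eventually)
qed

lemma smooth_on_differentiable:
  assumes "smooth_on S f" "open S" "x \<in> S"
  shows "(f has_derivative frechet_derivative f (at x)) (at x)"
  using smooth_on_imp_Ck[OF assms(2,1), of "Suc 0"] assms(3) by (rule Ck_on_SucD)

text \<open>Serves to show that the velocity of a jointly smooth family depends smoothly on the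
  angle.\<close>

lemma smooth_on_frechet_derivative:
  assumes "smooth_on S f" "open S"
  shows "smooth_on S (\<lambda>x. frechet_derivative f (at x) v)"
  by (rule Ck_imp_smooth_on[OF assms(2) Ck_on_SucD(2)[OF smooth_on_imp_Ck[OF assms(2,1)]]])

text \<open>One period is compact and carries all values. The bound later yields a single parameter
  interval valid for all angles.\<close>

lemma periodic_bounded:
  fixes f :: "real \<Rightarrow> 'b::real_normed_vector"
  assumes "continuous_on UNIV f" "\<And>\<theta>. f (\<theta> + 2 * pi) = f \<theta>"
  obtains B where "B > 0" "\<forall>\<theta>. norm (f \<theta>) \<le> B"
proof -
  have "bounded (f ` {0..2*pi})"
    by (intro compact_imp_bounded compact_continuous_image continuous_on_subset[OF assms(1)]) auto
  then obtain B where B: "B > 0" "\<forall>y\<in>f ` {0..2*pi}. norm y \<le> B" by (auto simp: bounded_pos)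
  have per: "f (\<theta> + of_int k * (2 * pi)) = f \<theta>" for k :: int and \<theta>
  proof -
    interpret periodic_fun_simple f "2 * pi" by unfold_locales (rule assms(2))
    show ?thesis by (rule plus_of_int)
  qed
  have "norm (f \<theta>) \<le> B" for \<theta>
  proof -
    \<comment> \<open>The number of whole periods to subtract in order to land in the compact
      interval.\<close>
    let ?k = "\<lfloor>\<theta> / (2 * pi)\<rfloor>"
    have "of_int ?k * (2 * pi) \<le> \<theta>"
      using of_int_floor_le[of "\<theta> / (2 * pi)"] by (subst (asm) pos_le_divide_eq) auto
    moreover have "\<theta> < (of_int ?k + 1) * (2 * pi)"
      using floor_correct[of "\<theta> / (2 * pi)"] by (subst (asm) pos_divide_less_eq) auto
    ultimately have "\<theta> + of_int (- ?k) * (2 * pi) \<in> {0..2*pi}" by (simp add: algebra_simps)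
    then have "norm (f (\<theta> + of_int (- ?k) * (2 * pi))) \<le> B" using B(2) by blast
    then show ?thesis unfolding per .
  qed
  then show thesis using B(1) that by blast
qed


section \<open>Charts\<close>

text \<open>The part of the definition of a manifold that products inherit from their factors without
  any work on countability or separation.\<close>

definition charted :: "('p, 'e::euclidean_space) mfd \<Rightarrow> bool" where
  "charted M \<longleftrightarrow> (\<Union>(U, \<phi>)\<in>atlas M. U) = topspace (mtop M) \<and>
     (\<forall>(U, \<phi>)\<in>atlas M. openin (mtop M) U \<and>
        homeomorphic_map (subtopology (mtop M) U) (top_of_set (\<phi> ` U)) \<phi>)"

lemma smooth_manifold_imp_charted: "smooth_manifold M \<Longrightarrow> charted M"
  unfolding smooth_manifold_def charted_def by auto

lemma charted_cover:
  assumes "charted M" "p \<in> topspace (mtop M)"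
  obtains U \<phi> where "(U, \<phi>) \<in> atlas M" "p \<in> U"
  using assms unfolding charted_def by blast

lemma chart_openin: "charted M \<Longrightarrow> (U, \<phi>) \<in> atlas M \<Longrightarrow> openin (mtop M) U"
  unfolding charted_def by (drule conjunct2, drule (1) bspec, simp)

lemma chart_homeomorphic_map:
  "charted M \<Longrightarrow> (U, \<phi>) \<in> atlas M \<Longrightarrow>
     homeomorphic_map (subtopology (mtop M) U) (top_of_set (\<phi> ` U)) \<phi>"
  unfolding charted_def by (drule conjunct2, drule (1) bspec, simp)

lemma chart_topspace:
  "charted M \<Longrightarrow> (U, \<phi>) \<in> atlas M \<Longrightarrow> topspace (subtopology (mtop M) U) = U"
  by (metis chart_openin openin_subset topspace_subtopology_subset)

lemma chart_inj_on: "charted M \<Longrightarrow> (U, \<phi>) \<in> atlas M \<Longrightarrow> inj_on \<phi> U"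
  using chart_homeomorphic_map[of M U \<phi>] chart_topspace[of M U \<phi>]
  by (simp add: homeomorphic_eq_everything_map)

text \<open>A chart image need not be open in the ambient Euclidean space, so the image of
  \<open>O'\<close> is given as the trace of an ambient open set, the form that
  \<open>smooth_on_local\<close> asks for.\<close>

lemma chart_open_image:
  assumes "charted M" "(U, \<phi>) \<in> atlas M" "openin (mtop M) O'" "O' \<subseteq> U"
  obtains E where "open E" "\<phi> ` O' = \<phi> ` U \<inter> E"
proof -
  have "openin (subtopology (mtop M) U) O'"
    using assms(3,4) chart_openin[OF assms(1,2)] by (simp add: openin_open_subtopology)
  then have "openin (top_of_set (\<phi> ` U)) (\<phi> ` O')"
    using homeomorphic_imp_open_map[OF chart_homeomorphic_map[OF assms(1,2)]]
    unfolding open_map_def by blast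
  then show thesis using that unfolding openin_open by blast
qed

lemma charted_open_mfd: "charted (open_mfd S)"
  unfolding charted_def open_mfd_def
  by (simp add: subtopology_subtopology)

text \<open>Group multiplication starts from \<open>prod_mfd M M\<close>, which appears as the
  intermediate space when it is composed with a pair of smooth maps; composition needs charts
  there.\<close>

lemma charted_prod_mfd:
  assumes M: "charted M" and N: "charted N" shows "charted (prod_mfd M N)"
  unfolding charted_def
proof (intro conjI)
  show "(\<Union>(U, \<phi>)\<in>atlas (prod_mfd M N). U) = topspace (mtop (prod_mfd M N))"
  proof (intro equalityI subsetI)
    fix z assume "z \<in> (\<Union>(U, \<phi>)\<in>atlas (prod_mfd M N). U)"
    then obtain U \<phi> V \<psi> where "(U, \<phi>) \<in> atlas M" "(V, \<psi>) \<in> atlas N" "z \<in> U \<times> V"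
      by (auto simp: prod_mfd_def)
    then show "z \<in> topspace (mtop (prod_mfd M N))"
      using openin_subset[OF chart_openin[OF M, of U \<phi>]] openin_subset[OF chart_openin[OF N, of V \<psi>]]
      by (auto simp: prod_mfd_def)
  next
    fix z assume "z \<in> topspace (mtop (prod_mfd M N))"
    then obtain x y where z: "z = (x, y)" "x \<in> topspace (mtop M)" "y \<in> topspace (mtop N)"
      by (auto simp: prod_mfd_def)
    obtain U \<phi> where U: "(U, \<phi>) \<in> atlas M" "x \<in> U" by (rule charted_cover[OF M z(2)])
    obtain V \<psi> where V: "(V, \<psi>) \<in> atlas N" "y \<in> V" by (rule charted_cover[OF N z(3)])
    have "(U \<times> V, map_prod \<phi> \<psi>) \<in> atlas (prod_mfd M N)"
      using U(1) V(1) by (auto simp: prod_mfd_def)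
    then show "z \<in> (\<Union>(U, \<phi>)\<in>atlas (prod_mfd M N). U)" using U(2) V(2) z(1) by blast
  qed
  have "openin (mtop (prod_mfd M N)) (U \<times> V) \<and>
      homeomorphic_map (subtopology (mtop (prod_mfd M N)) (U \<times> V))
        (top_of_set (map_prod \<phi> \<psi> ` (U \<times> V))) (map_prod \<phi> \<psi>)"
    if U: "(U, \<phi>) \<in> atlas M" and V: "(V, \<psi>) \<in> atlas N" for U V \<phi> \<psi>
  proof
    show "openin (mtop (prod_mfd M N)) (U \<times> V)"
      using chart_openin[OF M U] chart_openin[OF N V] by (simp add: prod_mfd_def openin_prod_Times_iff)
    obtain \<phi>' where "homeomorphic_maps (subtopology (mtop M) U) (top_of_set (\<phi> ` U)) \<phi> \<phi>'"
      using chart_homeomorphic_map[OF M U] by (auto simp: homeomorphic_map_maps)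
    moreover obtain \<psi>' where "homeomorphic_maps (subtopology (mtop N) V) (top_of_set (\<psi> ` V)) \<psi> \<psi>'"
      using chart_homeomorphic_map[OF N V] by (auto simp: homeomorphic_map_maps)
    ultimately have "homeomorphic_maps (prod_topology (subtopology (mtop M) U) (subtopology (mtop N) V))
        (prod_topology (top_of_set (\<phi> ` U)) (top_of_set (\<psi> ` V)))
        (\<lambda>(x, y). (\<phi> x, \<psi> y)) (\<lambda>(x, y). (\<phi>' x, \<psi>' y))"
      using homeomorphic_maps_prod by blast
    moreover have "(\<lambda>(x, y). (\<phi> x, \<psi> y)) = map_prod \<phi> \<psi>" by auto
    moreover have "map_prod \<phi> \<psi> ` (U \<times> V) = \<phi> ` U \<times> \<psi> ` V" by auto
    moreover have "top_of_set (\<phi> ` U \<times> \<psi> ` V) = prod_topology (top_of_set (\<phi> ` U)) (top_of_set (\<psi> ` V))"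
      by (metis subtopology_Times prod_topology_euclidean)
    ultimately have "homeomorphic_maps
        (prod_topology (subtopology (mtop M) U) (subtopology (mtop N) V))
        (top_of_set (map_prod \<phi> \<psi> ` (U \<times> V))) (map_prod \<phi> \<psi>) (\<lambda>(x, y). (\<phi>' x, \<psi>' y))"
      by metis
    moreover have "subtopology (mtop (prod_mfd M N)) (U \<times> V)
        = prod_topology (subtopology (mtop M) U) (subtopology (mtop N) V)"
      by (simp add: prod_mfd_def subtopology_Times)
    ultimately show "homeomorphic_map (subtopology (mtop (prod_mfd M N)) (U \<times> V))
        (top_of_set (map_prod \<phi> \<psi> ` (U \<times> V))) (map_prod \<phi> \<psi>)"
      unfolding homeomorphic_map_maps by metis
  qed
  note UV = this
  show "\<forall>(U, \<phi>)\<in>atlas (prod_mfd M N). openin (mtop (prod_mfd M N)) U \<and>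
      homeomorphic_map (subtopology (mtop (prod_mfd M N)) U) (top_of_set (\<phi> ` U)) \<phi>"
  proof
    fix \<kappa> assume "\<kappa> \<in> atlas (prod_mfd M N)"
    then obtain U \<phi> V \<psi> where "(U, \<phi>) \<in> atlas M" "(V, \<psi>) \<in> atlas N" "\<kappa> = (U \<times> V, map_prod \<phi> \<psi>)"
      by (auto simp: prod_mfd_def)
    then show "case \<kappa> of (U, \<phi>) \<Rightarrow> openin (mtop (prod_mfd M N)) U \<and>
        homeomorphic_map (subtopology (mtop (prod_mfd M N)) U) (top_of_set (\<phi> ` U)) \<phi>"
      using UV[of U \<phi> V \<psi>] by simp
  qed
qed


section \<open>Smooth maps between manifolds\<close>

lemma smooth_map_continuous: "smooth_map M N f \<Longrightarrow> continuous_map (mtop M) (mtop N) f"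
  by (simp add: smooth_map_def)

lemma smooth_map_funspace: "smooth_map M N f \<Longrightarrow> x \<in> topspace (mtop M) \<Longrightarrow> f x \<in> topspace (mtop N)"
  by (auto simp: smooth_map_def continuous_map_def)

lemma smooth_map_chart:
  "smooth_map M N f \<Longrightarrow> (U, \<phi>) \<in> atlas M \<Longrightarrow> (V, \<psi>) \<in> atlas N \<Longrightarrow>
     smooth_on (\<phi> ` {x\<in>U. f x \<in> V}) (\<lambda>z. \<psi> (f (inv_into U \<phi> z)))"
  unfolding smooth_map_def by (auto simp: o_def)

lemma smooth_mapI:
  assumes "continuous_map (mtop M) (mtop N) f"
    and "\<And>U \<phi> V \<psi>. (U, \<phi>) \<in> atlas M \<Longrightarrow> (V, \<psi>) \<in> atlas N \<Longrightarrow>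
     smooth_on (\<phi> ` {x\<in>U. f x \<in> V}) (\<lambda>z. \<psi> (f (inv_into U \<phi> z)))"
  shows "smooth_map M N f"
  using assms unfolding smooth_map_def by (auto simp: o_def)

text \<open>Near a point, a chart \<open>\<xi>\<close> of \<open>N\<close> around its image is
  inserted between \<open>f\<close> and \<open>g\<close>. The coordinate expression then factors
  into two smooth ones, and the choice of \<open>\<xi>\<close> may change from point to
  point.\<close>

lemma smooth_map_compose:
  assumes M: "charted M" and N: "charted N" and f: "smooth_map M N f" and g: "smooth_map N P g"
  shows "smooth_map M P (\<lambda>x. g (f x))"
proof (rule smooth_mapI)
  show "continuous_map (mtop M) (mtop P) (\<lambda>x. g (f x))"
    using continuous_map_compose[OF smooth_map_continuous[OF f] smooth_map_continuous[OF g]]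
    by (simp add: o_def)
next
  fix U \<phi> V \<psi> assume U: "(U, \<phi>) \<in> atlas M" and V: "(V, \<psi>) \<in> atlas P"
  let ?A = "{x\<in>U. g (f x) \<in> V}"
  show "smooth_on (\<phi> ` ?A) (\<lambda>z. \<psi> (g (f (inv_into U \<phi> z))))"
  proof (rule smooth_on_local)
    fix z assume "z \<in> \<phi> ` ?A"
    then obtain x where x: "x \<in> ?A" "z = \<phi> x" by blast
    then have "x \<in> topspace (mtop M)" using openin_subset[OF chart_openin[OF M U]] by auto
    then have "f x \<in> topspace (mtop N)" by (rule smooth_map_funspace[OF f])
    then obtain W \<xi> where W: "(W, \<xi>) \<in> atlas N" "f x \<in> W" by (rule charted_cover[OF N])
    let ?B = "{y\<in>U. f y \<in> W}"
    have eq: "U \<inter> {y\<in>topspace (mtop M). f y \<in> W} = ?B"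
      using openin_subset[OF chart_openin[OF M U]] by auto
    have B: "openin (mtop M) ?B"
      unfolding eq[symmetric] using openin_continuous_map_preimage[OF smooth_map_continuous[OF f]
          chart_openin[OF N W(1)]] by (rule openin_Int[OF chart_openin[OF M U]])
    have BU: "?B \<subseteq> U" by auto
    obtain E where E: "open E" "\<phi> ` ?B = \<phi> ` U \<inter> E"
      by (rule chart_open_image[OF M U B BU])
    have inv: "inv_into U \<phi> (\<phi> y) = y" if "y \<in> U" for y
      using chart_inj_on[OF M U] that by simp
    \<comment> \<open>Injectivity of \<open>\<phi>\<close> on \<open>U\<close> ensures that a
      coordinate lying in both images comes from one common point of the manifold.\<close>
    have sub: "\<phi> ` ?A \<inter> E \<subseteq> \<phi> ` (?A \<inter> ?B)"
    proof
      fix w assume w: "w \<in> \<phi> ` ?A \<inter> E"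
      then obtain y where y: "y \<in> ?A" "w = \<phi> y" by blast
      then have "w \<in> \<phi> ` ?B" using E(2) w by blast
      then obtain y' where y': "y' \<in> ?B" "w = \<phi> y'" by blast
      have "\<phi> y' = \<phi> y" by (rule trans[OF y'(2)[symmetric] y(2)])
      then have "y' = y" by (rule inj_onD[OF chart_inj_on[OF M U]]) (use y(1) y'(1) in simp_all)
      then have "y \<in> ?A \<inter> ?B" using y(1) y'(1) by simp
      then show "w \<in> \<phi> ` (?A \<inter> ?B)" unfolding y(2) by (rule imageI)
    qed
    have 1: "smooth_on (\<phi> ` (?A \<inter> ?B)) (\<lambda>z. \<xi> (f (inv_into U \<phi> z)))"
      by (rule smooth_on_subset[OF smooth_map_chart[OF f U W(1)]]) auto
    have "smooth_on (\<phi> ` (?A \<inter> ?B)) (\<lambda>z. \<psi> (g (inv_into W \<xi> (\<xi> (f (inv_into U \<phi> z))))))"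
      by (rule smooth_on_compose[OF 1 smooth_map_chart[OF g W(1) V]]) (auto simp: inv)
    then have "smooth_on (\<phi> ` (?A \<inter> ?B)) (\<lambda>z. \<psi> (g (f (inv_into U \<phi> z))))"
      by (rule smooth_on_cong) (auto simp: inv inv_into_f_f[OF chart_inj_on[OF N W(1)]])
    then have "smooth_on (\<phi> ` ?A \<inter> E) (\<lambda>z. \<psi> (g (f (inv_into U \<phi> z))))"
      using sub by (rule smooth_on_subset)
    moreover have "z \<in> \<phi> ` ?B" using x W(2) by auto
    then have "z \<in> E" using E(2) by auto
    ultimately show "\<exists>W. open W \<and> z \<in> W \<and> smooth_on (\<phi> ` ?A \<inter> W) (\<lambda>z. \<psi> (g (f (inv_into U \<phi> z))))"
      using E(1) by (intro exI[of _ E]) simp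
  qed
qed

lemma smooth_map_Pair:
  assumes f: "smooth_map K M f" and g: "smooth_map K N g"
  shows "smooth_map K (prod_mfd M N) (\<lambda>x. (f x, g x))"
proof (rule smooth_mapI)
  show "continuous_map (mtop K) (mtop (prod_mfd M N)) (\<lambda>x. (f x, g x))"
    using f g by (simp add: prod_mfd_def continuous_map_pairedI smooth_map_continuous)
next
  fix W \<xi> V \<psi> assume W: "(W, \<xi>) \<in> atlas K" and "(V, \<psi>) \<in> atlas (prod_mfd M N)"
  then obtain V1 \<alpha> V2 \<beta> where V: "(V1, \<alpha>) \<in> atlas M" "(V2, \<beta>) \<in> atlas N"
    "V = V1 \<times> V2" "\<psi> = map_prod \<alpha> \<beta>" by (auto simp: prod_mfd_def)
  have "smooth_on (\<xi> ` {x\<in>W. (f x, g x) \<in> V})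
      (\<lambda>z. (\<alpha> (f (inv_into W \<xi> z)), \<beta> (g (inv_into W \<xi> z))))"
    by (intro smooth_on_Pair smooth_on_subset[OF smooth_map_chart[OF f W V(1)]]
        smooth_on_subset[OF smooth_map_chart[OF g W V(2)]]) (auto simp: V)
  then show "smooth_on (\<xi> ` {x\<in>W. (f x, g x) \<in> V}) (\<lambda>z. \<psi> (f (inv_into W \<xi> z), g (inv_into W \<xi> z)))"
    by (simp add: V)
qed

lemma smooth_map_const: "a \<in> topspace (mtop N) \<Longrightarrow> smooth_map M N (\<lambda>x. a)"
  by (rule smooth_mapI) (auto intro: smooth_on_const)

text \<open>In charts the identity is a transition map, so this is the compatibility clause of the
  atlas. It is the device by which velocities are compared across charts.\<close>

lemma smooth_map_id:
  assumes "smooth_manifold M" shows "smooth_map M M (\<lambda>x. x)"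
proof (rule smooth_mapI)
  fix U \<phi> V \<psi> assume "(U, \<phi>) \<in> atlas M" "(V, \<psi>) \<in> atlas M"
  then have "smooth_on (\<phi> ` (U \<inter> V)) (\<psi> \<circ> inv_into U \<phi>)"
    using assms unfolding smooth_manifold_def by blast
  moreover have "{x\<in>U. x \<in> V} = U \<inter> V" by auto
  ultimately show "smooth_on (\<phi> ` {x\<in>U. x \<in> V}) (\<lambda>z. \<psi> (inv_into U \<phi> z))"
    by (simp add: o_def)
qed simp

text \<open>The only chart is \<open>id\<close>, whose \<open>inv_into\<close> is the identity on
  \<open>S\<close> and unspecified elsewhere; smoothness sees it only on \<open>S\<close>.\<close>

lemma smooth_map_open_mfd_iff:
  "smooth_map (open_mfd S) M f \<longleftrightarrow> continuous_map (top_of_set S) (mtop M) f \<and>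
     (\<forall>(U, \<phi>)\<in>atlas M. smooth_on {x\<in>S. f x \<in> U} (\<lambda>x. \<phi> (f x)))"
proof -
  have "smooth_on (id ` {x\<in>S. f x \<in> U}) (\<phi> \<circ> f \<circ> inv_into S id)
      \<longleftrightarrow> smooth_on {x\<in>S. f x \<in> U} (\<lambda>x. \<phi> (f x))" for U :: "'b set" and \<phi> :: "'b \<Rightarrow> 'c"
  proof -
    have inv: "inv_into S id x = x" if "x \<in> S" for x
      using inv_into_f_f[of id S x] that by simp
    have eq: "(\<phi> \<circ> f \<circ> inv_into S id) x = \<phi> (f x)" if "x \<in> {x\<in>S. f x \<in> U}" for x
      using that by (simp add: inv)
    show ?thesis
      using smooth_on_cong[of "{x\<in>S. f x \<in> U}" "\<phi> \<circ> f \<circ> inv_into S id" "\<lambda>x. \<phi> (f x)"] eq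
        smooth_on_cong[of "{x\<in>S. f x \<in> U}" "\<lambda>x. \<phi> (f x)" "\<phi> \<circ> f \<circ> inv_into S id"]
      by auto
  qed
  then show ?thesis unfolding smooth_map_def by (simp add: open_mfd_def)
qed

lemma smooth_map_open_mfd_chart:
  "smooth_map (open_mfd S) M f \<Longrightarrow> (U, \<phi>) \<in> atlas M \<Longrightarrow> smooth_on {x\<in>S. f x \<in> U} (\<lambda>x. \<phi> (f x))"
  unfolding smooth_map_open_mfd_iff by (drule conjunct2, drule (1) bspec, simp)

lemma smooth_map_open_mfd_preimage:
  assumes "smooth_map (open_mfd S) M f" "open S" "openin (mtop M) U"
  shows "open {x\<in>S. f x \<in> U}"
proof -
  have "openin (top_of_set S) {x\<in>topspace (top_of_set S). f x \<in> U}"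
    using assms(1,3) openin_continuous_map_preimage unfolding smooth_map_open_mfd_iff by blast
  then show ?thesis using assms(2) by (simp add: openin_open_eq)
qed

lemma smooth_map_open_mfds:
  assumes "smooth_on S f" "f ` S \<subseteq> R"
  shows "smooth_map (open_mfd S) (open_mfd R) f"
  unfolding smooth_map_open_mfd_iff
proof (intro conjI ballI)
  show "continuous_map (top_of_set S) (mtop (open_mfd R)) f"
    using smooth_on_imp_continuous_on[OF assms(1)] assms(2) by (auto simp: open_mfd_def)
next
  fix \<kappa> assume "\<kappa> \<in> atlas (open_mfd R)"
  then show "case \<kappa> of (U, \<phi>) \<Rightarrow> smooth_on {x\<in>S. f x \<in> U} (\<lambda>x. \<phi> (f x))"
    using smooth_on_subset[OF assms(1), of "{x\<in>S. f x \<in> R}"] by (auto simp: open_mfd_def)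
qed

lemma smooth_map_reparam:
  assumes "smooth_map (open_mfd R) M F" "smooth_on S f" "f ` S \<subseteq> R"
  shows "smooth_map (open_mfd S) M (\<lambda>x. F (f x))"
  by (rule smooth_map_compose[OF charted_open_mfd charted_open_mfd smooth_map_open_mfds[OF assms(2,3)] assms(1)])


section \<open>Velocities\<close>

lemma has_vector_derivative_chain:
  assumes "(g has_vector_derivative v) (at x)" "(f has_derivative D) (at (g x))"
  shows "((\<lambda>s. f (g s)) has_vector_derivative D v) (at x)"
proof -
  have "((\<lambda>s. f (g s)) has_derivative (\<lambda>s. D (s *\<^sub>R v))) (at x)"
    using diff_chain_at[OF assms(1)[unfolded has_vector_derivative_def] assms(2)]
    by (simp add: o_def)
  moreover have "D (s *\<^sub>R v) = s *\<^sub>R D v" for s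
    using has_derivative_linear[OF assms(2)] by (simp add: linear_scale)
  ultimately show ?thesis by (simp add: has_vector_derivative_def)
qed

text \<open>Difference quotients stay in \<open>V\<close>, and a subspace of a Euclidean space is
  closed.\<close>

lemma has_vector_derivative_in_subspace:
  fixes f :: "real \<Rightarrow> 'a::euclidean_space"
  assumes "(f has_vector_derivative v) (at x)" "subspace V" "\<forall>\<^sub>F s in nhds x. f s \<in> V"
  shows "v \<in> V"
proof -
  have "((\<lambda>s. (f s - f x) /\<^sub>R (s - x)) \<longlongrightarrow> v) (at x)"
  proof -
    have "((\<lambda>s. norm ((f s - f x) /\<^sub>R (s - x) - v)) \<longlongrightarrow> 0) (at x)"
    proof (rule Lim_transform_eventually)
      show "((\<lambda>s. norm (f s - f x - (s - x) *\<^sub>R v) / norm (s - x)) \<longlongrightarrow> 0) (at x)"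
        using assms(1) by (simp add: has_vector_derivative_def has_derivative_at2 has_derivative_iff_norm)
      show "\<forall>\<^sub>F s in at x. norm (f s - f x - (s - x) *\<^sub>R v) / norm (s - x)
          = norm ((f s - f x) /\<^sub>R (s - x) - v)"
      proof -
        have "norm (f s - f x - (s - x) *\<^sub>R v) / norm (s - x) = norm ((f s - f x) /\<^sub>R (s - x) - v)"
          if "s \<noteq> x" for s
        proof -
          have "(f s - f x) /\<^sub>R (s - x) - v = (f s - f x - (s - x) *\<^sub>R v) /\<^sub>R (s - x)"
            using that by (simp add: scaleR_diff_right)
          then show ?thesis by (simp add: divide_inverse mult.commute)
        qed
        then show ?thesis by (auto simp: eventually_at_filter)
      qed
    qed
    then show ?thesis by (rule LIM_zero_cancel[OF tendsto_norm_zero_cancel])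
  qed
  moreover have "\<forall>\<^sub>F s in at x. (f s - f x) /\<^sub>R (s - x) \<in> V"
  proof -
    have fx: "f x \<in> V" using eventually_nhds_x_imp_x[OF assms(3)] .
    have "\<forall>\<^sub>F s in at x. f s \<in> V"
      unfolding eventually_at_filter using assms(3) by (rule eventually_mono) simp
    then show ?thesis
    proof eventually_elim
      case (elim s)
      with fx show ?case by (intro subspace_scale subspace_diff assms(2))
    qed
  qed
  ultimately show ?thesis
    by (intro Lim_in_closed_set[OF closed_subspace[OF assms(2)], of _ "at x"]) auto
qed

text \<open>Group laws hold only inside the carrier, which a curve is known to respect only near 0,
  so curves are compared as germs. The filter \<open>nhds 0\<close> includes 0 itself, whose value
  decides which charts count.\<close>

lemma velocity_cong:
  fixes M :: "('p, 'e::euclidean_space) mfd"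
  assumes "\<forall>\<^sub>F s in nhds 0. c s = d s"
  shows "velocity M c = velocity M d"
proof
  fix \<kappa> :: "('p, 'e) chart"
  have "c 0 = d 0" using eventually_nhds_x_imp_x[OF assms] .
  moreover have "\<forall>\<^sub>F s in nhds 0. s \<in> UNIV \<longrightarrow> (snd \<kappa> \<circ> c) s = (snd \<kappa> \<circ> d) s"
    using assms by (rule eventually_mono) simp
  then have "vector_derivative (snd \<kappa> \<circ> c) (at 0) = vector_derivative (snd \<kappa> \<circ> d) (at 0)"
    by (rule vector_derivative_cong_eq) auto
  ultimately show "velocity M c \<kappa> = velocity M d \<kappa>" by (simp add: velocity_def)
qed

lemma velocity_outside: "\<not> (\<kappa> \<in> atlas M \<and> c 0 \<in> fst \<kappa>) \<Longrightarrow> velocity M c \<kappa> = 0"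
  by (auto simp: velocity_def)

lemma velocity_const: "velocity M (\<lambda>s. a) = (\<lambda>_. 0)"
  by (rule ext) (simp add: velocity_def o_def)

lemma smooth_curve_atE:
  assumes "smooth_curve_at M p c"
  obtains \<epsilon> where "\<epsilon> > 0" "smooth_map (open_mfd {-\<epsilon><..<\<epsilon>}) M c" "c 0 = p"
  using assms unfolding smooth_curve_at_def by auto

lemma smooth_curve_atI:
  "\<epsilon> > 0 \<Longrightarrow> smooth_map (open_mfd {-\<epsilon><..<\<epsilon>}) M c \<Longrightarrow> c 0 = p \<Longrightarrow> smooth_curve_at M p c"
  unfolding smooth_curve_at_def by auto

lemma eventually_interval:
  assumes "(\<epsilon>::real) > 0" "\<And>s. s \<in> {-\<epsilon><..<\<epsilon>} \<Longrightarrow> P s" shows "\<forall>\<^sub>F s in nhds 0. P s"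
  unfolding eventually_nhds
  by (rule exI[of _ "{-\<epsilon><..<\<epsilon>}"]) (use assms in auto)

lemma smooth_curve_at_topspace:
  assumes "smooth_curve_at M p c" shows "p \<in> topspace (mtop M)"
proof -
  obtain \<epsilon> where \<epsilon>: "\<epsilon> > 0" "smooth_map (open_mfd {-\<epsilon><..<\<epsilon>}) M c" "c 0 = p"
    by (rule smooth_curve_atE[OF assms])
  show ?thesis using smooth_map_funspace[OF \<epsilon>(2), of 0] \<epsilon>(1,3) by (simp add: open_mfd_def)
qed

lemma smooth_curve_at_eventually:
  assumes "smooth_curve_at M p c" "openin (mtop M) U" "p \<in> U"
  shows "\<forall>\<^sub>F s in nhds 0. c s \<in> U"
proof -
  obtain \<epsilon> where \<epsilon>: "\<epsilon> > 0" "smooth_map (open_mfd {-\<epsilon><..<\<epsilon>}) M c" "c 0 = p"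
    by (rule smooth_curve_atE[OF assms(1)])
  have "open {s\<in>{-\<epsilon><..<\<epsilon>}. c s \<in> U}"
    by (rule smooth_map_open_mfd_preimage[OF \<epsilon>(2) _ assms(2)]) simp
  moreover have "0 \<in> {s\<in>{-\<epsilon><..<\<epsilon>}. c s \<in> U}" using \<epsilon> assms(3) by simp
  ultimately show ?thesis unfolding eventually_nhds by blast
qed

lemma smooth_curve_at_velocity:
  assumes "charted M" "smooth_curve_at M p c" "(U, \<phi>) \<in> atlas M" "p \<in> U"
  shows "((\<lambda>s. \<phi> (c s)) has_vector_derivative velocity M c (U, \<phi>)) (at 0)"
proof -
  obtain \<epsilon> where \<epsilon>: "\<epsilon> > 0" "smooth_map (open_mfd {-\<epsilon><..<\<epsilon>}) M c" "c 0 = p"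
    by (rule smooth_curve_atE[OF assms(2)])
  let ?S = "{s\<in>{-\<epsilon><..<\<epsilon>}. c s \<in> U}"
  have "open ?S"
    by (rule smooth_map_open_mfd_preimage[OF \<epsilon>(2) _ chart_openin[OF assms(1,3)]]) simp
  moreover have "0 \<in> ?S" using \<epsilon> assms(4) by simp
  ultimately have "((\<lambda>s. \<phi> (c s)) has_derivative frechet_derivative (\<lambda>s. \<phi> (c s)) (at 0)) (at 0)"
    by (rule smooth_on_differentiable[OF smooth_map_open_mfd_chart[OF \<epsilon>(2) assms(3)]])
  then have "(\<lambda>s. \<phi> (c s)) differentiable (at 0)" unfolding differentiable_def by blast
  then have "((\<lambda>s. \<phi> (c s)) has_vector_derivative vector_derivative (\<lambda>s. \<phi> (c s)) (at 0)) (at 0)"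
    by (simp add: vector_derivative_works)
  then show ?thesis using assms(3,4) \<epsilon>(3) by (simp add: velocity_def o_def)
qed

lemma smooth_curve_at_compose:
  assumes "charted M" "smooth_map M N f" "smooth_curve_at M p c"
  shows "smooth_curve_at N (f p) (\<lambda>s. f (c s))"
proof -
  obtain \<epsilon> where \<epsilon>: "\<epsilon> > 0" "smooth_map (open_mfd {-\<epsilon><..<\<epsilon>}) M c" "c 0 = p"
    by (rule smooth_curve_atE[OF assms(3)])
  show ?thesis
    by (rule smooth_curve_atI[OF \<epsilon>(1) smooth_map_compose[OF charted_open_mfd assms(1) \<epsilon>(2) assms(2)]])
      (simp add: \<epsilon>(3))
qed

text \<open>One \<open>D\<close> serves all curves through \<open>p\<close>: it is the derivative at
  \<open>\<phi> p\<close> of a fixed local extension \<open>h\<close> of the coordinate expression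
  of \<open>f\<close>. Passing through \<open>h\<close> avoids any openness of chart images in the
  ambient space.\<close>

lemma velocity_compose_chart:
  assumes M: "charted M" and f: "smooth_map M N f" and U: "(U, \<phi>) \<in> atlas M" "p \<in> U"
    and V: "(V, \<psi>) \<in> atlas N" "f p \<in> V" "openin (mtop N) V"
  obtains D where "\<And>c. smooth_curve_at M p c \<Longrightarrow>
    velocity N (\<lambda>s. f (c s)) (V, \<psi>) = D (velocity M c (U, \<phi>))"
proof -
  let ?A = "{x\<in>U. f x \<in> V}"
  have "\<phi> p \<in> \<phi> ` ?A" using U(2) V(2) by auto
  then obtain W h where W: "open W" "\<phi> p \<in> W" "\<forall>k. Ck_on k W h"
    "\<forall>z. z \<in> \<phi> ` ?A \<longrightarrow> z \<in> W \<longrightarrow> h z = \<psi> (f (inv_into U \<phi> z))"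
    by (rule smooth_onE[OF smooth_map_chart[OF f U(1) V(1)]])
  let ?D = "frechet_derivative h (at (\<phi> p))"
  have h: "(h has_derivative ?D) (at (\<phi> p))"
    by (rule Ck_on_SucD(1)[OF W(3)[rule_format] W(2)])
  have "velocity N (\<lambda>s. f (c s)) (V, \<psi>) = ?D (velocity M c (U, \<phi>))" if c: "smooth_curve_at M p c" for c
  proof -
    note v = smooth_curve_at_velocity[OF M c U]
    have c0: "c 0 = p" using c by (simp add: smooth_curve_at_def)
    have "((\<lambda>s. h (\<phi> (c s))) has_vector_derivative ?D (velocity M c (U, \<phi>))) (at 0)"
      by (rule has_vector_derivative_chain[OF v]) (simp add: c0 h)
    \<comment> \<open>The extension matches the coordinate expression only within both charts and
      \<open>W\<close>; by continuity the curve stays there for small parameters.\<close>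
    moreover have "\<forall>\<^sub>F s in nhds 0. h (\<phi> (c s)) = \<psi> (f (c s))"
    proof -
      have "\<forall>\<^sub>F s in nhds 0. c s \<in> U"
        by (rule smooth_curve_at_eventually[OF c chart_openin[OF M U(1)] U(2)])
      moreover have "\<forall>\<^sub>F s in nhds 0. f (c s) \<in> V"
        by (rule smooth_curve_at_eventually[OF smooth_curve_at_compose[OF M f c] V(3,2)])
      moreover have "\<forall>\<^sub>F s in nhds 0. \<phi> (c s) \<in> W"
      proof -
        have "isCont (\<lambda>s. \<phi> (c s)) 0" using v by (rule has_vector_derivative_continuous)
        then have "\<forall>\<^sub>F s in at 0. \<phi> (c s) \<in> W"
          unfolding isCont_def using W(1,2) c0 by (intro topological_tendstoD) auto
        then show ?thesis using W(2) c0 by (simp add: eventually_nhds_conv_at)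
      qed
      ultimately show ?thesis
      proof eventually_elim
        case (elim s)
        then have "\<phi> (c s) \<in> \<phi> ` ?A" by blast
        then have "h (\<phi> (c s)) = \<psi> (f (inv_into U \<phi> (\<phi> (c s))))"
          using W(4) elim(3) by blast
        then show ?case using inv_into_f_f[OF chart_inj_on[OF M U(1)] elim(1)] by simp
      qed
    qed
    then have "\<forall>\<^sub>F s in nhds 0. s \<in> UNIV \<longrightarrow> h (\<phi> (c s)) = \<psi> (f (c s))"
      by (rule eventually_mono) simp
    then have "vector_derivative (\<lambda>s. h (\<phi> (c s))) (at 0) = vector_derivative (\<lambda>s. \<psi> (f (c s))) (at 0)"
      by (rule vector_derivative_cong_eq) auto
    ultimately have "vector_derivative (\<lambda>s. \<psi> (f (c s))) (at 0) = ?D (velocity M c (U, \<phi>))"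
      by (simp add: vector_derivative_at)
    then show ?thesis using V(1,2) c0 by (simp add: velocity_def o_def)
  qed
  then show thesis by (rule that)
qed

text \<open>A single coordinate at \<open>p\<close> determines the image velocity in every chart
  around \<open>f p\<close>, because the linear factor is shared by all curves.\<close>

lemma velocity_compose_eq:
  assumes M: "charted M" and N: "charted N" and f: "smooth_map M N f"
    and c: "smooth_curve_at M p c" and d: "smooth_curve_at M p d"
    and U: "(U, \<phi>) \<in> atlas M" "p \<in> U" and eq: "velocity M c (U, \<phi>) = velocity M d (U, \<phi>)"
  shows "velocity N (\<lambda>s. f (c s)) = velocity N (\<lambda>s. f (d s))"
proof
  fix \<kappa> :: "('c, 'd) chart"
  obtain V \<psi> where \<kappa>: "\<kappa> = (V, \<psi>)" by (cases \<kappa>)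
  have 0: "c 0 = p" "d 0 = p" using c d by (simp_all add: smooth_curve_at_def)
  show "velocity N (\<lambda>s. f (c s)) \<kappa> = velocity N (\<lambda>s. f (d s)) \<kappa>"
  proof (cases "(V, \<psi>) \<in> atlas N \<and> f p \<in> V")
    case True
    then have V: "(V, \<psi>) \<in> atlas N" "f p \<in> V" by auto
    obtain D where "\<And>c. smooth_curve_at M p c \<Longrightarrow>
        velocity N (\<lambda>s. f (c s)) (V, \<psi>) = D (velocity M c (U, \<phi>))"
      using velocity_compose_chart[OF M f U V chart_openin[OF N V(1)]] by metis
    then show ?thesis using c d eq \<kappa> by metis
  next
    case False
    then show ?thesis using 0 \<kappa> by (simp add: velocity_outside)
  qed
qed

text \<open>The preceding lemma for the identity map: a tangent vector is a family over all charts,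
  but one chart decides it.\<close>

lemma velocity_eqI:
  assumes "smooth_manifold M" "smooth_curve_at M p c" "smooth_curve_at M p d"
    and "(U, \<phi>) \<in> atlas M" "p \<in> U" "velocity M c (U, \<phi>) = velocity M d (U, \<phi>)"
  shows "velocity M c = velocity M d"
  using velocity_compose_eq[OF smooth_manifold_imp_charted[OF assms(1)]
      smooth_manifold_imp_charted[OF assms(1)] smooth_map_id[OF assms(1)] assms(2-)] .

lemma velocity_compose_cong:
  assumes M: "charted M" and N: "charted N" and f: "smooth_map M N f"
    and c: "smooth_curve_at M p c" and d: "smooth_curve_at M p d"
    and eq: "velocity M c = velocity M d"
  shows "velocity N (\<lambda>s. f (c s)) = velocity N (\<lambda>s. f (d s))"
proof -
  obtain U \<phi> where U: "(U, \<phi>) \<in> atlas M" "p \<in> U"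
    by (rule charted_cover[OF M smooth_curve_at_topspace[OF c]])
  show ?thesis by (rule velocity_compose_eq[OF M N f c d U]) (simp add: eq)
qed

text \<open>Removes the choice in \<open>tangent_map\<close>: whichever curve is picked, its
  velocity is the given one, and the image velocity depends on nothing else.\<close>

lemma tangent_map_velocity:
  assumes "charted M" "charted N" "smooth_map M N f" "smooth_curve_at M p c"
  shows "tangent_map M N f p (velocity M c) = velocity N (\<lambda>s. f (c s))"
proof -
  let ?d = "SOME d. smooth_curve_at M p d \<and> velocity M d = velocity M c"
  have d: "smooth_curve_at M p ?d \<and> velocity M ?d = velocity M c"
    by (rule someI[where x = c]) (use assms(4) in simp)
  have "velocity N (\<lambda>s. f (?d s)) = velocity N (\<lambda>s. f (c s))"
    using d by (intro velocity_compose_cong[OF assms(1-3) _ assms(4)]) auto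
  then show ?thesis unfolding tangent_map_def by (simp add: o_def)
qed

text \<open>Linearity of the total derivative at the origin on the direction
  \<open>(1, 1) = (1, 0) + (0, 1)\<close>. The product rule for curves in the group rests on
  this.\<close>

lemma velocity_diagonal:
  assumes M: "charted M" and \<epsilon>: "\<epsilon> > 0"
    and F: "smooth_map (open_mfd ({-\<epsilon><..<\<epsilon>} \<times> {-\<epsilon><..<\<epsilon>})) M (\<lambda>(s, r). F s r)"
  shows "velocity M (\<lambda>s. F s s) \<kappa> = velocity M (\<lambda>s. F s 0) \<kappa> + velocity M (\<lambda>s. F 0 s) \<kappa>"
proof -
  obtain U \<phi> where \<kappa>: "\<kappa> = (U, \<phi>)" by (cases \<kappa>)
  show ?thesis
  proof (cases "(U, \<phi>) \<in> atlas M \<and> F 0 0 \<in> U")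
    case True
    then have U: "(U, \<phi>) \<in> atlas M" "F 0 0 \<in> U" by auto
    let ?I = "{-\<epsilon><..<\<epsilon>} \<times> {-\<epsilon><..<\<epsilon>}" and ?f = "\<lambda>z. \<phi> (case z of (s, r) \<Rightarrow> F s r)"
    let ?S = "{z\<in>?I. (case z of (s, r) \<Rightarrow> F s r) \<in> U}" and ?D = "frechet_derivative ?f (at (0, 0))"
    have "open ?S"
      by (rule smooth_map_open_mfd_preimage[OF F _ chart_openin[OF M U(1)]]) (simp add: open_Times)
    moreover have "(0, 0) \<in> ?S" using \<epsilon> U(2) by simp
    ultimately have f: "(?f has_derivative ?D) (at (0, 0))"
      by (rule smooth_on_differentiable[OF smooth_map_open_mfd_chart[OF F U(1)]])
    \<comment> \<open>The slope pairs (1, 1), (1, 0) and (0, 1) give the three curves of the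
      statement.\<close>
    have line: "vector_derivative (\<lambda>s. \<phi> (F (a * s) (b * s))) (at 0) = ?D (a, b)" for a b :: real
    proof -
      have "((\<lambda>s. s *\<^sub>R (a, b)) has_vector_derivative (a, b)) (at 0)"
        by (auto simp: has_vector_derivative_def intro!: derivative_eq_intros)
      then have "((\<lambda>s. ?f (s *\<^sub>R (a, b))) has_vector_derivative ?D (a, b)) (at 0)"
        by (rule has_vector_derivative_chain) (use f in \<open>simp add: zero_prod_def\<close>)
      then show ?thesis by (simp add: vector_derivative_at mult.commute)
    qed
    have "?D ((1, 0) + (0, 1)) = ?D (1, 0) + ?D (0, 1)"
      using has_derivative_linear[OF f] by (rule linear_add)
    then have "?D (1, 1) = ?D (1, 0) + ?D (0, 1)" by simp
    then show ?thesis using U line[of 1 1] line[of 1 0] line[of 0 1] \<kappa>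
      by (simp add: velocity_def o_def)
  next
    case False
    then show ?thesis using \<kappa> by (simp add: velocity_outside)
  qed
qed

text \<open>The coordinate velocity is the partial derivative of a smooth function in direction
  \<open>(1, 0)\<close>. As all curves start at the same \<open>p\<close>, a chart counts for every
  angle or for none, so the default value 0 creates no jump.\<close>

lemma velocity_family_smooth:
  assumes M: "charted M" and \<epsilon>: "\<epsilon> > 0" and F: "smooth_map (open_mfd ({-\<epsilon><..<\<epsilon>} \<times> UNIV)) M (\<lambda>(s, \<theta>). F s \<theta>)"
    and p: "\<And>\<theta>. F 0 \<theta> = p"
  shows "smooth_on (UNIV :: real set) (\<lambda>\<theta>. velocity M (\<lambda>s. F s \<theta>) \<kappa>)"
proof -
  obtain U \<phi> where \<kappa>: "\<kappa> = (U, \<phi>)" by (cases \<kappa>)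
  show ?thesis
  proof (cases "(U, \<phi>) \<in> atlas M \<and> p \<in> U")
    case True
    then have U: "(U, \<phi>) \<in> atlas M" "p \<in> U" by auto
    let ?I = "{-\<epsilon><..<\<epsilon>} \<times> (UNIV :: real set)" and ?f = "\<lambda>z. \<phi> (case z of (s, r) \<Rightarrow> F s r)"
    let ?S = "{z\<in>?I. (case z of (s, r) \<Rightarrow> F s r) \<in> U}"
    have S: "open ?S"
      by (rule smooth_map_open_mfd_preimage[OF F _ chart_openin[OF M U(1)]]) (simp add: open_Times)
    have f: "smooth_on ?S ?f" by (rule smooth_map_open_mfd_chart[OF F U(1)])
    have mem: "(0, \<theta>) \<in> ?S" for \<theta> using \<epsilon> U(2) p by simp
    have eq: "frechet_derivative ?f (at (0, \<theta>)) (1, 0) = velocity M (\<lambda>s. F s \<theta>) \<kappa>" for \<theta>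
    proof -
      have "((\<lambda>s. (s, \<theta>)) has_vector_derivative (1, 0)) (at 0)"
        by (auto simp: has_vector_derivative_def intro!: derivative_eq_intros)
      then have "((\<lambda>s. ?f (s, \<theta>)) has_vector_derivative frechet_derivative ?f (at (0, \<theta>)) (1, 0)) (at 0)"
        by (rule has_vector_derivative_chain) (rule smooth_on_differentiable[OF f S mem])
      then show ?thesis using U p \<kappa> by (simp add: velocity_def o_def vector_derivative_at)
    qed
    have "smooth_on UNIV (\<lambda>\<theta>::real. (0::real, \<theta>))"
      by (intro smooth_on_Pair smooth_on_const smooth_on_id)
    then have "smooth_on UNIV (\<lambda>\<theta>. frechet_derivative ?f (at (0, \<theta>)) (1, 0))"
      by (rule smooth_on_compose[OF _ smooth_on_frechet_derivative[OF f S]]) (use mem in auto)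
    then show ?thesis unfolding eq .
  next
    case False
    then have "(\<lambda>\<theta>. velocity M (\<lambda>s. F s \<theta>) \<kappa>) = (\<lambda>\<theta>. 0)"
      using \<kappa> p by (simp add: velocity_outside)
    then show ?thesis by (simp add: smooth_on_const)
  qed
qed


section \<open>Lie groups\<close>

locale lie_group_mfd = group +
  fixes M :: "('a, 'e::euclidean_space) mfd"
  assumes lie_group: "lie_group G M"
begin

lemma manifold: "smooth_manifold M"
  using lie_group by (simp add: lie_group_def)

lemma charted: "charted M"
  by (rule smooth_manifold_imp_charted[OF manifold])

lemma topspace_eq: "topspace (mtop M) = carrier G"
  using lie_group by (simp add: lie_group_def)

lemma smooth_map_carrier: "smooth_map (open_mfd S) M f \<Longrightarrow> x \<in> S \<Longrightarrow> f x \<in> carrier G"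
  using smooth_map_funspace[of "open_mfd S" M f x] by (simp add: topspace_eq open_mfd_def)

lemma smooth_map_mult:
  assumes "charted K" "smooth_map K M f" "smooth_map K M g"
  shows "smooth_map K M (\<lambda>x. f x \<otimes> g x)"
proof -
  have "smooth_map (prod_mfd M M) M (\<lambda>(x, y). x \<otimes> y)"
    using lie_group by (simp add: lie_group_def)
  from smooth_map_compose[OF assms(1) charted_prod_mfd[OF charted charted]
      smooth_map_Pair[OF assms(2,3)] this]
  show ?thesis by simp
qed

lemma smooth_map_inv:
  assumes "charted K" "smooth_map K M f" shows "smooth_map K M (\<lambda>x. inv (f x))"
proof -
  have "smooth_map M M (\<lambda>x. inv x)"
    using lie_group by (simp add: lie_group_def)
  from smooth_map_compose[OF assms(1) charted assms(2) this] show ?thesis .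
qed

lemma smooth_map_element: "a \<in> carrier G \<Longrightarrow> smooth_map K M (\<lambda>x. a)"
  by (rule smooth_map_const) (simp add: topspace_eq)

lemmas smooth_map_group_intros =
  smooth_map_mult[OF charted] smooth_map_inv[OF charted] smooth_map_element smooth_map_id[OF manifold]

lemmas smooth_map_open_group_intros =
  smooth_map_mult[OF charted_open_mfd] smooth_map_inv[OF charted_open_mfd] smooth_map_element

lemma smooth_curve_at_eventually_carrier:
  assumes "smooth_curve_at M p c" shows "\<forall>\<^sub>F s in nhds 0. c s \<in> carrier G"
  using smooth_curve_at_eventually[OF assms openin_topspace smooth_curve_at_topspace[OF assms]]
  by (simp only: topspace_eq)

text \<open>The base points are arbitrary, not just \<open>\<one>\<close>, because the derivative of
  the action multiplies curves through general values of the loop.\<close>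

lemma smooth_curve_at_mult:
  assumes "smooth_curve_at M p A" "smooth_curve_at M q B"
  shows "smooth_curve_at M (p \<otimes> q) (\<lambda>s. A s \<otimes> B s)"
    and "velocity M (\<lambda>s. A s \<otimes> B s) \<kappa> =
      velocity M (\<lambda>s. A s \<otimes> q) \<kappa> + velocity M (\<lambda>s. p \<otimes> B s) \<kappa>"
proof -
  obtain a where a: "a > 0" "smooth_map (open_mfd {-a<..<a}) M A" "A 0 = p"
    by (rule smooth_curve_atE[OF assms(1)])
  obtain b where b: "b > 0" "smooth_map (open_mfd {-b<..<b}) M B" "B 0 = q"
    by (rule smooth_curve_atE[OF assms(2)])
  let ?e = "min a b"
  let ?I = "{-?e<..<?e}"
  have e: "?e > 0" using a(1) b(1) by simp
  have "smooth_map (open_mfd ?I) M (\<lambda>s. A s \<otimes> B s)"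
    by (intro smooth_map_open_group_intros smooth_map_reparam[OF a(2) smooth_on_id]
        smooth_map_reparam[OF b(2) smooth_on_id]) auto
  then show "smooth_curve_at M (p \<otimes> q) (\<lambda>s. A s \<otimes> B s)"
    by (rule smooth_curve_atI[OF e]) (simp add: a b)
  \<comment> \<open>Independent parameters for the two factors: setting one of them to 0 freezes
    that factor at its base point.\<close>
  have "smooth_map (open_mfd (?I \<times> ?I)) M (\<lambda>z. A (fst z) \<otimes> B (snd z))"
    by (intro smooth_map_open_group_intros smooth_map_reparam[OF a(2)] smooth_map_reparam[OF b(2)]
        smooth_on_bounded_linear bounded_linear_fst bounded_linear_snd) auto
  then have "smooth_map (open_mfd (?I \<times> ?I)) M (\<lambda>(s, r). A s \<otimes> B r)"
    by (simp add: case_prod_beta')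
  from velocity_diagonal[OF charted e this, of \<kappa>]
  show "velocity M (\<lambda>s. A s \<otimes> B s) \<kappa> = velocity M (\<lambda>s. A s \<otimes> q) \<kappa> + velocity M (\<lambda>s. p \<otimes> B s) \<kappa>"
    by (simp add: a(3) b(3))
qed

lemma smooth_curve_at_inv: "smooth_curve_at M p A \<Longrightarrow> smooth_curve_at M (inv p) (\<lambda>s. inv (A s))"
  by (rule smooth_curve_at_compose[OF charted smooth_map_inv[OF charted smooth_map_id[OF manifold]]])

lemma velocity_mult_one:
  assumes "smooth_curve_at M \<one> A" "smooth_curve_at M \<one> B"
  shows "velocity M (\<lambda>s. A s \<otimes> B s) \<kappa> = velocity M A \<kappa> + velocity M B \<kappa>"
proof -
  have "velocity M (\<lambda>s. A s \<otimes> \<one>) = velocity M A"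
    by (rule velocity_cong, rule eventually_mono[OF smooth_curve_at_eventually_carrier[OF assms(1)]]) simp
  moreover have "velocity M (\<lambda>s. \<one> \<otimes> B s) = velocity M B"
    by (rule velocity_cong, rule eventually_mono[OF smooth_curve_at_eventually_carrier[OF assms(2)]]) simp
  ultimately show ?thesis using smooth_curve_at_mult(2)[OF assms] by simp
qed

text \<open>The product of a curve with its inverse is constantly \<open>\<one>\<close> near 0, so
  the two velocities cancel.\<close>

lemma velocity_inv_one:
  assumes "smooth_curve_at M \<one> A"
  shows "velocity M (\<lambda>s. inv (A s)) \<kappa> = - velocity M A \<kappa>"
proof -
  have inv: "smooth_curve_at M \<one> (\<lambda>s. inv (A s))"
    using smooth_curve_at_inv[OF assms] by simp
  have "velocity M (\<lambda>s. A s \<otimes> inv (A s)) = velocity M (\<lambda>s. \<one>)"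
    by (rule velocity_cong, rule eventually_mono[OF smooth_curve_at_eventually_carrier[OF assms]]) simp
  then have "velocity M A \<kappa> + velocity M (\<lambda>s. inv (A s)) \<kappa> = 0"
    using velocity_mult_one[OF assms inv, of \<kappa>] by (simp add: velocity_const)
  then show ?thesis by (simp add: eq_neg_iff_add_eq_0 add.commute)
qed

section \<open>The Lie algebra and the adjoint action through representing curves\<close>

lemma lie_algebraE:
  assumes "X \<in> lie_algebra G M"
  obtains A where "smooth_curve_at M \<one> A" "X = velocity M A"
  using assms by (auto simp: lie_algebra_def tangent_space_def)

lemma lie_algebraI: "smooth_curve_at M \<one> A \<Longrightarrow> velocity M A \<in> lie_algebra G M"
  by (auto simp: lie_algebra_def tangent_space_def)

text \<open>The representing curve is the product of the two given ones. Together with negation this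
  makes translation by a constant loop preserve classes.\<close>

lemma lie_algebra_add:
  assumes "X \<in> lie_algebra G M" "Y \<in> lie_algebra G M"
  shows "(\<lambda>\<kappa>. X \<kappa> + Y \<kappa>) \<in> lie_algebra G M"
proof -
  obtain A where A: "smooth_curve_at M \<one> A" "X = velocity M A" by (rule lie_algebraE[OF assms(1)])
  obtain B where B: "smooth_curve_at M \<one> B" "Y = velocity M B" by (rule lie_algebraE[OF assms(2)])
  have "(\<lambda>\<kappa>. X \<kappa> + Y \<kappa>) = velocity M (\<lambda>s. A s \<otimes> B s)"
    by (rule ext) (simp add: velocity_mult_one A B)
  then show ?thesis using lie_algebraI smooth_curve_at_mult(1)[OF A(1) B(1)] by simp
qed

lemma lie_algebra_uminus:
  assumes "X \<in> lie_algebra G M" shows "(\<lambda>\<kappa>. - X \<kappa>) \<in> lie_algebra G M"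
proof -
  obtain A where A: "smooth_curve_at M \<one> A" "X = velocity M A" by (rule lie_algebraE[OF assms(1)])
  have "(\<lambda>\<kappa>. - X \<kappa>) = velocity M (\<lambda>s. inv (A s))"
    by (rule ext) (simp add: velocity_inv_one A)
  then show ?thesis using lie_algebraI smooth_curve_at_inv[OF A(1)] by simp
qed

lemma smooth_curve_at_conj:
  assumes "g \<in> carrier G" "smooth_curve_at M \<one> A"
  shows "smooth_curve_at M \<one> (\<lambda>s. g \<otimes> A s \<otimes> inv g)"
proof -
  have "smooth_map M M (\<lambda>x. g \<otimes> x \<otimes> inv g)"
    using assms(1) by (intro smooth_map_group_intros) auto
  from smooth_curve_at_compose[OF charted this assms(2)] show ?thesis using assms(1) by simp
qed

lemma Ad_velocity:
  assumes "g \<in> carrier G" "smooth_curve_at M \<one> A"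
  shows "Ad G M g (velocity M A) = velocity M (\<lambda>s. g \<otimes> A s \<otimes> inv g)"
proof -
  have "smooth_map M M (\<lambda>x. g \<otimes> x \<otimes> inv g)"
    using assms(1) by (intro smooth_map_group_intros) auto
  from tangent_map_velocity[OF charted charted this assms(2)] show ?thesis by (simp add: Ad_def)
qed

lemma chart_model:
  assumes "(U, \<phi>) \<in> atlas M"
  shows "openin (top_of_set (model M)) (\<phi> ` U)" "subspace (model M)"
proof -
  have "\<forall>(U, \<phi>)\<in>atlas M. openin (mtop M) U \<and> openin (top_of_set (model M)) (\<phi> ` U) \<and>
        homeomorphic_map (subtopology (mtop M) U) (top_of_set (\<phi> ` U)) \<phi>"
    using manifold unfolding smooth_manifold_def by (elim conjE) assumption
  from bspec[OF this assms] show "openin (top_of_set (model M)) (\<phi> ` U)" by simp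
  show "subspace (model M)"
    using manifold unfolding smooth_manifold_def by (elim conjE) assumption
qed

text \<open>Keeps the straight lines used for surjectivity of the left trivialisation inside the
  model subspace, relative to which chart images are open.\<close>

lemma velocity_in_model:
  assumes "(U, \<phi>) \<in> atlas M" "p \<in> U" "smooth_curve_at M p c"
  shows "velocity M c (U, \<phi>) \<in> model M"
proof (rule has_vector_derivative_in_subspace)
  show "((\<lambda>s. \<phi> (c s)) has_vector_derivative velocity M c (U, \<phi>)) (at 0)"
    by (rule smooth_curve_at_velocity[OF charted assms(3,1,2)])
  show "subspace (model M)" by (rule chart_model(2)[OF assms(1)])
  have "\<phi> ` U \<subseteq> model M" using openin_subset[OF chart_model(1)[OF assms(1)]] by simp
  then show "\<forall>\<^sub>F s in nhds 0. \<phi> (c s) \<in> model M"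
    by (intro eventually_mono[OF smooth_curve_at_eventually[OF assms(3)
            chart_openin[OF charted assms(1)] assms(2)]]) auto
qed

text \<open>Read in another chart, the inverse of a chart is a transition map. This is the tool for
  building maps into the group from coordinates.\<close>

lemma smooth_map_inv_chart:
  assumes U: "(U, \<phi>) \<in> atlas M" and f: "smooth_on S f" "f ` S \<subseteq> \<phi> ` U"
  shows "smooth_map (open_mfd S) M (\<lambda>x. inv_into U \<phi> (f x))"
  unfolding smooth_map_open_mfd_iff
proof (intro conjI ballI)
  obtain g where "homeomorphic_maps (subtopology (mtop M) U) (top_of_set (\<phi> ` U)) \<phi> g"
    using chart_homeomorphic_map[OF charted U] by (auto simp: homeomorphic_map_maps)
  then have g: "continuous_map (top_of_set (\<phi> ` U)) (subtopology (mtop M) U) g"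
    "\<forall>x\<in>topspace (subtopology (mtop M) U). g (\<phi> x) = x"
    by (simp_all add: homeomorphic_maps_def)
  \<comment> \<open>Continuity is known for the inverse \<open>g\<close> supplied by the
    homeomorphism; it agrees with \<open>inv_into\<close> on the chart image, where \<open>f\<close>
    takes its values.\<close>
  have g_eq: "g z = inv_into U \<phi> z" if z: "z \<in> \<phi> ` U" for z
  proof -
    obtain x where x: "x \<in> U" "z = \<phi> x" using z by blast
    then show ?thesis
      using g(2) inv_into_f_f[OF chart_inj_on[OF charted U] x(1)] chart_topspace[OF charted U] by simp
  qed
  have "continuous_map (top_of_set S) (top_of_set (\<phi> ` U)) f"
    using smooth_on_imp_continuous_on[OF f(1)] f(2) by auto
  from continuous_map_compose[OF this g(1)]
  have "continuous_map (top_of_set S) (mtop M) (g \<circ> f)" by (simp add: continuous_map_in_subtopology)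
  then show "continuous_map (top_of_set S) (mtop M) (\<lambda>x. inv_into U \<phi> (f x))"
    by (rule continuous_map_eq) (use f(2) g_eq in auto)
next
  fix \<kappa> assume \<kappa>: "\<kappa> \<in> atlas M"
  obtain V \<psi> where V: "\<kappa> = (V, \<psi>)" by (cases \<kappa>)
  let ?S = "{x\<in>S. inv_into U \<phi> (f x) \<in> V}"
  have "smooth_on (\<phi> ` {x\<in>U. x \<in> V}) (\<lambda>z. \<psi> (inv_into U \<phi> z))"
    using smooth_map_chart[OF smooth_map_id[OF manifold] U] \<kappa> V by simp
  moreover have "f ` ?S \<subseteq> \<phi> ` {x\<in>U. x \<in> V}"
  proof
    fix z assume "z \<in> f ` ?S"
    then have z: "z \<in> \<phi> ` U" "inv_into U \<phi> z \<in> V" using f(2) by auto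
    then show "z \<in> \<phi> ` {x\<in>U. x \<in> V}"
      by (intro image_eqI[of _ _ "inv_into U \<phi> z"]) (auto simp: f_inv_into_f inv_into_into)
  qed
  ultimately have "smooth_on ?S (\<lambda>x. \<psi> (inv_into U \<phi> (f x)))"
    by (rule smooth_on_compose[OF smooth_on_subset[OF f(1)], rotated]) auto
  then show "case \<kappa> of (V, \<psi>) \<Rightarrow> smooth_on {x\<in>S. inv_into U \<phi> (f x) \<in> V} (\<lambda>x. \<psi> (inv_into U \<phi> (f x)))"
    by (simp add: V)
qed


section \<open>Loops\<close>

lemma based_loops_carrier: "\<gamma> \<in> based_loops G M \<Longrightarrow> \<gamma> \<theta> \<in> carrier G"
  using smooth_map_carrier[of UNIV \<gamma> \<theta>] by (simp add: based_loops_def)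

lemma loop_curve_atE:
  assumes "loop_curve_at G M \<gamma> c"
  obtains \<epsilon> where "\<epsilon> > 0" "\<forall>s\<in>{-\<epsilon><..<\<epsilon>}. c s \<in> based_loops G M"
    "smooth_map (open_mfd ({-\<epsilon><..<\<epsilon>} \<times> UNIV)) M (\<lambda>(s, \<theta>). c s \<theta>)" "c 0 = \<gamma>"
  using assms unfolding loop_curve_at_def by auto

lemma loop_curve_at_based:
  assumes "loop_curve_at G M \<gamma> c" shows "\<gamma> \<in> based_loops G M"
proof -
  obtain \<epsilon> where \<epsilon>: "\<epsilon> > 0" "\<forall>s\<in>{-\<epsilon><..<\<epsilon>}. c s \<in> based_loops G M"
    "smooth_map (open_mfd ({-\<epsilon><..<\<epsilon>} \<times> UNIV)) M (\<lambda>(s, \<theta>). c s \<theta>)" "c 0 = \<gamma>"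
    by (rule loop_curve_atE[OF assms])
  show ?thesis using bspec[OF \<epsilon>(2), of 0] \<epsilon>(1,4) by simp
qed

text \<open>Covers freezing the angle, freezing the curve parameter and shifting the angle in a
  jointly smooth family.\<close>

lemma smooth_map_substitute:
  assumes "smooth_map (open_mfd (I \<times> UNIV)) M (\<lambda>(s, \<theta>). c s \<theta>)" "smooth_on S f" "smooth_on S g"
    "f ` S \<subseteq> I"
  shows "smooth_map (open_mfd S) M (\<lambda>x. c (f x) (g x))"
proof -
  have "smooth_map (open_mfd S) M (\<lambda>x. case (f x, g x) of (s, \<theta>) \<Rightarrow> c s \<theta>)"
    by (rule smooth_map_reparam[OF assms(1) smooth_on_Pair[OF assms(2,3)]]) (use assms(4) in auto)
  then show ?thesis by simp
qed

lemma loop_curve_at_eval: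
  assumes "loop_curve_at G M \<gamma> c" shows "smooth_curve_at M (\<gamma> \<theta>) (\<lambda>s. c s \<theta>)"
proof -
  obtain \<epsilon> where \<epsilon>: "\<epsilon> > 0" "\<forall>s\<in>{-\<epsilon><..<\<epsilon>}. c s \<in> based_loops G M"
    "smooth_map (open_mfd ({-\<epsilon><..<\<epsilon>} \<times> UNIV)) M (\<lambda>(s, \<theta>). c s \<theta>)" "c 0 = \<gamma>"
    by (rule loop_curve_atE[OF assms])
  show ?thesis
    by (rule smooth_curve_atI[OF \<epsilon>(1) smooth_map_substitute[OF \<epsilon>(3) smooth_on_id smooth_on_const]])
      (auto simp: \<epsilon>(4))
qed

lemma left_triv_velocity:
  assumes "loop_curve_at G M \<gamma> c"
  shows "left_triv G M \<gamma> (loop_velocity M c) \<theta> = velocity M (\<lambda>s. inv (\<gamma> \<theta>) \<otimes> c s \<theta>)"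
proof -
  have "smooth_map M M (\<lambda>x. inv (\<gamma> \<theta>) \<otimes> x)"
    using based_loops_carrier[OF loop_curve_at_based[OF assms], of \<theta>]
    by (intro smooth_map_group_intros) simp
  from tangent_map_velocity[OF charted charted this loop_curve_at_eval[OF assms, of \<theta>]]
  show ?thesis by (simp add: left_triv_def loop_velocity_def)
qed

lemma smooth_curve_at_left_triv:
  assumes "loop_curve_at G M \<gamma> c"
  shows "smooth_curve_at M \<one> (\<lambda>s. inv (\<gamma> \<theta>) \<otimes> c s \<theta>)"
proof -
  have \<gamma>: "\<gamma> \<theta> \<in> carrier G" by (rule based_loops_carrier[OF loop_curve_at_based[OF assms]])
  then have "smooth_map M M (\<lambda>x. inv (\<gamma> \<theta>) \<otimes> x)" by (intro smooth_map_group_intros) simp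
  from smooth_curve_at_compose[OF charted this loop_curve_at_eval[OF assms, of \<theta>]] \<gamma>
  show ?thesis by simp
qed

text \<open>The shift is built in for two uses: \<open>\<psi> = 0\<close> for the trivialisation
  itself, general \<open>\<psi>\<close> for the rotated curve.\<close>

lemma smooth_map_left_triv:
  assumes "\<gamma> \<in> based_loops G M" "smooth_map (open_mfd (I \<times> UNIV)) M (\<lambda>(s, \<theta>). c s \<theta>)"
  shows "smooth_map (open_mfd (I \<times> UNIV)) M (\<lambda>(s, \<theta>). inv (\<gamma> (\<theta> + \<psi>)) \<otimes> c s (\<theta> + \<psi>))"
proof -
  have \<gamma>: "smooth_map (open_mfd UNIV) M \<gamma>" using assms(1) by (simp add: based_loops_def)
  have shift: "smooth_on (I \<times> UNIV) (\<lambda>z. snd z + \<psi>)"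
    by (intro smooth_on_add smooth_on_const smooth_on_bounded_linear bounded_linear_snd)
  have fst: "smooth_on (I \<times> UNIV) fst" by (intro smooth_on_bounded_linear bounded_linear_fst)
  have "smooth_map (open_mfd (I \<times> UNIV)) M (\<lambda>z. inv (\<gamma> (snd z + \<psi>)) \<otimes> c (fst z) (snd z + \<psi>))"
    by (intro smooth_map_open_group_intros smooth_map_reparam[OF \<gamma> shift]
        smooth_map_substitute[OF assms(2) fst shift]) auto
  then show ?thesis by (simp add: case_prod_beta')
qed

text \<open>Membership in \<open>algebra_loops\<close> is obtained by exhibiting a jointly smooth,
  periodic family of curves through \<open>\<one>\<close>; here both the trivialised velocity and
  its adjoint rotation arise so.\<close>

lemma velocity_algebra_loops:
  assumes "\<epsilon> > 0" "smooth_map (open_mfd ({-\<epsilon><..<\<epsilon>} \<times> UNIV)) M (\<lambda>(s, \<theta>). F s \<theta>)"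
    and "\<And>\<theta>. F 0 \<theta> = \<one>" and "\<And>s \<theta>. s \<in> {-\<epsilon><..<\<epsilon>} \<Longrightarrow> F s (\<theta> + 2 * pi) = F s \<theta>"
  shows "(\<lambda>\<theta>. velocity M (\<lambda>s. F s \<theta>)) \<in> algebra_loops G M"
proof -
  have "smooth_curve_at M \<one> (\<lambda>s. F s \<theta>)" for \<theta>
    by (rule smooth_curve_atI[OF assms(1) smooth_map_substitute[OF assms(2) smooth_on_id smooth_on_const]])
      (auto simp: assms(3))
  moreover have "velocity M (\<lambda>s. F s (\<theta> + 2 * pi)) = velocity M (\<lambda>s. F s \<theta>)" for \<theta>
    by (rule velocity_cong, rule eventually_interval[OF assms(1)]) (rule assms(4))
  moreover have "smooth_on UNIV (\<lambda>\<theta>. velocity M (\<lambda>s. F s \<theta>) \<kappa>)" for \<kappa>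
    by (rule velocity_family_smooth[OF charted assms(1-3)])
  ultimately show ?thesis by (simp add: algebra_loops_def lie_algebraI)
qed

lemma based_loops_period: "\<gamma> \<in> based_loops G M \<Longrightarrow> \<gamma> (\<theta> + 2 * pi) = \<gamma> \<theta>"
  by (simp add: based_loops_def)

lemma based_loops_period': "\<gamma> \<in> based_loops G M \<Longrightarrow> \<gamma> (\<theta> + 2 * pi + \<psi>) = \<gamma> (\<theta> + \<psi>)"
  using based_loops_period[of \<gamma> "\<theta> + \<psi>"] by (simp add: algebra_simps)

lemma left_triv_based:
  assumes "loop_curve_at G M \<gamma> c"
  shows "left_triv G M \<gamma> (loop_velocity M c) \<in> based_algebra_loops G M"
proof -
  obtain \<epsilon> where \<epsilon>: "\<epsilon> > 0" "\<forall>s\<in>{-\<epsilon><..<\<epsilon>}. c s \<in> based_loops G M"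
    "smooth_map (open_mfd ({-\<epsilon><..<\<epsilon>} \<times> UNIV)) M (\<lambda>(s, \<theta>). c s \<theta>)" "c 0 = \<gamma>"
    by (rule loop_curve_atE[OF assms])
  have \<gamma>: "\<gamma> \<in> based_loops G M" by (rule loop_curve_at_based[OF assms])
  have "(\<lambda>\<theta>. velocity M (\<lambda>s. inv (\<gamma> \<theta>) \<otimes> c s \<theta>)) \<in> algebra_loops G M"
  proof (rule velocity_algebra_loops[OF \<epsilon>(1)])
    show "smooth_map (open_mfd ({-\<epsilon><..<\<epsilon>} \<times> UNIV)) M (\<lambda>(s, \<theta>). inv (\<gamma> \<theta>) \<otimes> c s \<theta>)"
      using smooth_map_left_triv[OF \<gamma> \<epsilon>(3), of 0] by simp
    show "inv (\<gamma> \<theta>) \<otimes> c 0 \<theta> = \<one>" for \<theta>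
      using based_loops_carrier[OF \<gamma>] by (simp add: \<epsilon>(4))
    show "inv (\<gamma> (\<theta> + 2 * pi)) \<otimes> c s (\<theta> + 2 * pi) = inv (\<gamma> \<theta>) \<otimes> c s \<theta>"
      if "s \<in> {-\<epsilon><..<\<epsilon>}" for s \<theta>
      using based_loops_period[OF \<gamma>, of \<theta>] based_loops_period[OF \<epsilon>(2)[rule_format, OF that], of \<theta>] by simp
  qed
  \<comment> \<open>All the loops are based, so at angle 0 the curve is constantly
    \<open>\<one>\<close> near parameter 0.\<close>
  moreover have "velocity M (\<lambda>s. inv (\<gamma> 0) \<otimes> c s 0) = velocity M (\<lambda>s. \<one>)"
    by (rule velocity_cong, rule eventually_interval[OF \<epsilon>(1)])
      (use \<gamma> \<epsilon>(2) in \<open>simp add: based_loops_def\<close>)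
  moreover have "left_triv G M \<gamma> (loop_velocity M c) = (\<lambda>\<theta>. velocity M (\<lambda>s. inv (\<gamma> \<theta>) \<otimes> c s \<theta>))"
    using left_triv_velocity[OF assms] by blast
  ultimately show ?thesis by (simp add: based_algebra_loops_def velocity_const)
qed

lemma loop_tangent_spaceE:
  assumes "\<delta> \<in> loop_tangent_space G M \<gamma>"
  obtains c where "loop_curve_at G M \<gamma> c" "\<delta> = loop_velocity M c"
  using assms unfolding loop_tangent_space_def by auto

lemma l_cancel_inv: "x \<in> carrier G \<Longrightarrow> y \<in> carrier G \<Longrightarrow> x \<otimes> (inv x \<otimes> y) = y"
  "x \<in> carrier G \<Longrightarrow> y \<in> carrier G \<Longrightarrow> inv x \<otimes> (x \<otimes> y) = y"
  by (simp_all flip: m_assoc)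

text \<open>Multiplying by \<open>\<gamma> \<theta>\<close> on the left undoes the translation angle
  by angle, and a smooth map carries equal velocities to equal velocities.\<close>

lemma left_triv_inj_on: "inj_on (left_triv G M \<gamma>) (loop_tangent_space G M \<gamma>)"
proof (rule inj_onI)
  fix \<delta> \<delta>' assume "\<delta> \<in> loop_tangent_space G M \<gamma>" and "\<delta>' \<in> loop_tangent_space G M \<gamma>"
    and eq: "left_triv G M \<gamma> \<delta> = left_triv G M \<gamma> \<delta>'"
  then obtain c d where c: "loop_curve_at G M \<gamma> c" "\<delta> = loop_velocity M c"
    and d: "loop_curve_at G M \<gamma> d" "\<delta>' = loop_velocity M d"
    by (auto elim!: loop_tangent_spaceE)
  show "\<delta> = \<delta>'"
  proof
    fix \<theta>
    have \<gamma>: "\<gamma> \<theta> \<in> carrier G" by (rule based_loops_carrier[OF loop_curve_at_based[OF c(1)]])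
    have recover: "velocity M (\<lambda>s. c s \<theta>) = velocity M (\<lambda>s. \<gamma> \<theta> \<otimes> (inv (\<gamma> \<theta>) \<otimes> c s \<theta>))"
      if "loop_curve_at G M \<gamma> c" for c
      by (rule velocity_cong,
          rule eventually_mono[OF smooth_curve_at_eventually_carrier[OF loop_curve_at_eval[OF that, of \<theta>]]])
        (simp add: \<gamma> l_cancel_inv)
    have "velocity M (\<lambda>s. inv (\<gamma> \<theta>) \<otimes> c s \<theta>) = velocity M (\<lambda>s. inv (\<gamma> \<theta>) \<otimes> d s \<theta>)"
      using eq left_triv_velocity[OF c(1), of \<theta>] left_triv_velocity[OF d(1), of \<theta>] c(2) d(2) by simp
    moreover have "smooth_map M M (\<lambda>x. \<gamma> \<theta> \<otimes> x)" using \<gamma> by (intro smooth_map_group_intros)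
    ultimately have "velocity M (\<lambda>s. \<gamma> \<theta> \<otimes> (inv (\<gamma> \<theta>) \<otimes> c s \<theta>)) = velocity M (\<lambda>s. \<gamma> \<theta> \<otimes> (inv (\<gamma> \<theta>) \<otimes> d s \<theta>))"
      using velocity_compose_cong[OF charted charted _ smooth_curve_at_left_triv[OF c(1)]
          smooth_curve_at_left_triv[OF d(1)]] by blast
    then show "\<delta> \<theta> = \<delta>' \<theta>" using recover[OF c(1)] recover[OF d(1)] c(2) d(2) by (simp add: loop_velocity_def)
  qed
qed

text \<open>A loop \<open>X\<close> in the Lie algebra is realised by the curve whose left translate moves along
  straight lines in a chart at the identity. This needs no exponential map; compactness of the
  circle provides a common parameter interval.\<close>

lemma left_triv_surj:
  assumes \<gamma>: "\<gamma> \<in> based_loops G M" and X: "X \<in> based_algebra_loops G M"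
  obtains c where "loop_curve_at G M \<gamma> c" "left_triv G M \<gamma> (loop_velocity M c) = X"
proof -
  have "\<one> \<in> topspace (mtop M)" by (simp add: topspace_eq)
  then obtain U \<phi> where U: "(U, \<phi>) \<in> atlas M" "\<one> \<in> U" by (rule charted_cover[OF charted])
  define x where "x \<theta> = X \<theta> (U, \<phi>)" for \<theta>
  have X_lie: "X \<theta> \<in> lie_algebra G M" and X_per: "X (\<theta> + 2 * pi) = X \<theta>"
    and X_smooth: "smooth_on UNIV (\<lambda>\<theta>. X \<theta> \<kappa>)" and X_0: "X 0 = (\<lambda>_. 0)" for \<theta> \<kappa>
    using X by (simp_all add: based_algebra_loops_def algebra_loops_def del: split_paired_All)
  have x: "smooth_on UNIV x" "x (\<theta> + 2 * pi) = x \<theta>" "x 0 = 0" for \<theta>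
    using X_smooth[of "(U, \<phi>)"] by (simp_all add: x_def[abs_def] X_per X_0)
  have x_model: "x \<theta> \<in> model M" for \<theta>
  proof -
    obtain d where "smooth_curve_at M \<one> d" "X \<theta> = velocity M d" by (rule lie_algebraE[OF X_lie])
    then show ?thesis using velocity_in_model[OF U] by (simp add: x_def)
  qed
  obtain B where B: "B > 0" "\<forall>\<theta>. norm (x \<theta>) \<le> B"
    by (rule periodic_bounded[OF smooth_on_imp_continuous_on[OF x(1)] x(2)])
  have \<phi>1: "\<phi> \<one> \<in> \<phi> ` U" using U(2) by blast
  obtain r where r: "r > 0" "ball (\<phi> \<one>) r \<inter> model M \<subseteq> \<phi> ` U"
    using chart_model(1)[OF U(1)] \<phi>1 unfolding openin_contains_ball by blast
  have \<phi>1_model: "\<phi> \<one> \<in> model M"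
    using openin_subset[OF chart_model(1)[OF U(1)]] \<phi>1 by auto
  \<comment> \<open>With \<open>norm (x \<theta>) \<le> B\<close> at every angle, the displacement
    \<open>s *\<^sub>R x \<theta>\<close> has norm below \<open>r\<close> as soon as
    \<open>\<bar>s\<bar> < r / B\<close>.\<close>
  define \<epsilon> where "\<epsilon> = r / B"
  have \<epsilon>: "\<epsilon> > 0" using r(1) B(1) by (simp add: \<epsilon>_def)
  let ?I = "{-\<epsilon><..<\<epsilon>} \<times> (UNIV :: real set)"
  have mem: "\<phi> \<one> + s *\<^sub>R x \<theta> \<in> \<phi> ` U" if s: "s \<in> {-\<epsilon><..<\<epsilon>}" for s \<theta>
  proof -
    have "norm (s *\<^sub>R x \<theta>) \<le> \<bar>s\<bar> * B" using B(2) by (simp add: mult_left_mono)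
    also have "\<dots> < \<epsilon> * B" using s B(1) by (intro mult_strict_right_mono) auto
    also have "\<dots> = r" using B(1) by (simp add: \<epsilon>_def)
    finally have "\<phi> \<one> + s *\<^sub>R x \<theta> \<in> ball (\<phi> \<one>) r" by (simp add: dist_norm)
    moreover have "\<phi> \<one> + s *\<^sub>R x \<theta> \<in> model M"
      by (intro subspace_add subspace_scale chart_model(2)[OF U(1)] \<phi>1_model x_model)
    ultimately show ?thesis using r(2) by auto
  qed
  define e where "e s \<theta> = inv_into U \<phi> (\<phi> \<one> + s *\<^sub>R x \<theta>)" for s \<theta>
  define c where "c s \<theta> = \<gamma> \<theta> \<otimes> e s \<theta>" for s \<theta>
  have fst: "smooth_on ?I fst" and snd: "smooth_on ?I snd"
    by (intro smooth_on_bounded_linear bounded_linear_fst bounded_linear_snd)+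
  have e: "smooth_map (open_mfd ?I) M (\<lambda>z. e (fst z) (snd z))"
    unfolding e_def
  proof (rule smooth_map_inv_chart[OF U(1)])
    show "smooth_on ?I (\<lambda>z. \<phi> \<one> + fst z *\<^sub>R x (snd z))"
      by (intro smooth_on_add smooth_on_const smooth_on_scaleR fst smooth_on_compose[OF snd x(1)]) simp
    show "(\<lambda>z. \<phi> \<one> + fst z *\<^sub>R x (snd z)) ` ?I \<subseteq> \<phi> ` U" using mem by auto
  qed
  have "smooth_map (open_mfd UNIV) M \<gamma>" using \<gamma> by (simp add: based_loops_def)
  then have c_smooth: "smooth_map (open_mfd ?I) M (\<lambda>(s, \<theta>). c s \<theta>)"
    unfolding c_def case_prod_beta'
    by (intro smooth_map_open_group_intros e smooth_map_reparam[OF _ snd]) auto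
  have e_carrier: "e s \<theta> \<in> carrier G" if "s \<in> {-\<epsilon><..<\<epsilon>}" for s \<theta>
    using smooth_map_carrier[OF e, of "(s, \<theta>)"] that by simp
  \<comment> \<open>The hypothesis covers two cases at once: \<open>s = 0\<close>, where the curve
    starts at \<open>\<gamma>\<close>, and \<open>\<theta> = 0\<close>, where \<open>x\<close>
    vanishes and the loops stay based.\<close>
  have e_one: "e s \<theta> = \<one>" if "s *\<^sub>R x \<theta> = 0" for s \<theta>
    using inv_into_f_f[OF chart_inj_on[OF charted U(1)] U(2)] that by (auto simp: e_def)
  have c_based: "c s \<in> based_loops G M" if s: "s \<in> {-\<epsilon><..<\<epsilon>}" for s
  proof -
    have "smooth_map (open_mfd UNIV) M (c s)"
      by (rule smooth_map_substitute[OF c_smooth smooth_on_const smooth_on_id]) (use s in auto)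
    moreover have "c s (\<theta> + 2 * pi) = c s \<theta>" for \<theta>
      by (simp add: c_def e_def x(2) based_loops_period[OF \<gamma>])
    moreover have "c s 0 = \<one>"
      using \<gamma> e_one[of s 0] x(3) by (simp add: c_def based_loops_def)
    ultimately show ?thesis by (simp add: based_loops_def)
  qed
  have "c 0 = \<gamma>"
    using e_one[of 0] based_loops_carrier[OF \<gamma>] by (auto simp: c_def)
  then have c: "loop_curve_at G M \<gamma> c"
    unfolding loop_curve_at_def using \<epsilon> c_based c_smooth by blast
  have "left_triv G M \<gamma> (loop_velocity M c) \<theta> = X \<theta>" for \<theta>
  proof -
    obtain d where d: "smooth_curve_at M \<one> d" "X \<theta> = velocity M d" by (rule lie_algebraE[OF X_lie])
    have e_smooth: "smooth_map (open_mfd ?I) M (\<lambda>(s, \<theta>). e s \<theta>)" using e by (simp add: case_prod_beta')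
    have e_curve: "smooth_curve_at M \<one> (\<lambda>s. e s \<theta>)"
      by (rule smooth_curve_atI[OF \<epsilon> smooth_map_substitute[OF e_smooth smooth_on_id smooth_on_const]])
        (use e_one[of 0] in auto)
    have "velocity M (\<lambda>s. inv (\<gamma> \<theta>) \<otimes> c s \<theta>) = velocity M (\<lambda>s. e s \<theta>)"
      by (rule velocity_cong, rule eventually_interval[OF \<epsilon>])
        (simp add: c_def l_cancel_inv based_loops_carrier[OF \<gamma>] e_carrier)
    \<comment> \<open>By construction only the coordinate in \<open>(U, \<phi>)\<close> is
      prescribed; \<open>velocity_eqI\<close> extends the agreement to all other charts.\<close>
    also have "\<dots> = velocity M d"
    proof (rule velocity_eqI[OF manifold e_curve d(1) U])
      have "((\<lambda>s. \<phi> \<one> + s *\<^sub>R x \<theta>) has_vector_derivative x \<theta>) (at 0)"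
        by (auto simp: has_vector_derivative_def intro!: derivative_eq_intros)
      moreover have "\<forall>\<^sub>F s in nhds 0. s \<in> UNIV \<longrightarrow> \<phi> (e s \<theta>) = \<phi> \<one> + s *\<^sub>R x \<theta>"
        by (rule eventually_interval[OF \<epsilon>]) (simp add: e_def f_inv_into_f[OF mem])
      then have "vector_derivative (\<lambda>s. \<phi> (e s \<theta>)) (at 0) = vector_derivative (\<lambda>s. \<phi> \<one> + s *\<^sub>R x \<theta>) (at 0)"
        by (rule vector_derivative_cong_eq) auto
      ultimately have "vector_derivative (\<lambda>s. \<phi> (e s \<theta>)) (at 0) = x \<theta>"
        by (simp add: vector_derivative_at)
      then show "velocity M (\<lambda>s. e s \<theta>) (U, \<phi>) = velocity M d (U, \<phi>)"
        using U e_one[of 0 \<theta>] by (simp add: velocity_def[of M "\<lambda>s. e s \<theta>"] o_def x_def d(2))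
    qed
    finally show ?thesis using left_triv_velocity[OF c] d(2) by simp
  qed
  then show thesis using that[OF c] by blast
qed

lemma left_triv_bij_betw:
  assumes "\<gamma> \<in> based_loops G M"
  shows "bij_betw (left_triv G M \<gamma>) (loop_tangent_space G M \<gamma>) (based_algebra_loops G M)"
proof (rule bij_betw_imageI[OF left_triv_inj_on])
  show "left_triv G M \<gamma> ` loop_tangent_space G M \<gamma> = based_algebra_loops G M"
  proof (intro equalityI subsetI)
    fix X assume "X \<in> left_triv G M \<gamma> ` loop_tangent_space G M \<gamma>"
    then show "X \<in> based_algebra_loops G M"
      using left_triv_based by (auto simp: loop_tangent_space_def)
  next
    fix X assume "X \<in> based_algebra_loops G M"
    then obtain c where "loop_curve_at G M \<gamma> c" "left_triv G M \<gamma> (loop_velocity M c) = X"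
      by (rule left_triv_surj[OF assms])
    then show "X \<in> left_triv G M \<gamma> ` loop_tangent_space G M \<gamma>"
      by (auto simp: loop_tangent_space_def)
  qed
qed


section \<open>The isotropy representation\<close>

lemma torus_action_apply:
  "torus_action G t \<psi> \<gamma> \<theta> = t \<otimes> (\<gamma> (\<theta> + \<psi>) \<otimes> inv (\<gamma> \<psi>)) \<otimes> inv t"
  by (simp add: torus_action_def conj_action_def rot_action_def)

text \<open>The factor \<open>inv (c s \<psi>)\<close>, constant in the angle, keeps every moved
  loop based.\<close>

lemma loop_curve_at_torus_action:
  assumes t: "t \<in> carrier G" and c: "loop_curve_at G M \<gamma> c"
  shows "loop_curve_at G M (torus_action G t \<psi> \<gamma>) (torus_action G t \<psi> \<circ> c)"
proof -
  obtain \<epsilon> where \<epsilon>: "\<epsilon> > 0" "\<forall>s\<in>{-\<epsilon><..<\<epsilon>}. c s \<in> based_loops G M"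
    "smooth_map (open_mfd ({-\<epsilon><..<\<epsilon>} \<times> UNIV)) M (\<lambda>(s, \<theta>). c s \<theta>)" "c 0 = \<gamma>"
    by (rule loop_curve_atE[OF c])
  let ?I = "{-\<epsilon><..<\<epsilon>} \<times> (UNIV :: real set)"
  have "smooth_map (open_mfd ?I) M
      (\<lambda>z. t \<otimes> (c (fst z) (snd z + \<psi>) \<otimes> inv (c (fst z) \<psi>)) \<otimes> inv t)"
    using t by (intro smooth_map_open_group_intros smooth_map_substitute[OF \<epsilon>(3)] smooth_on_add
        smooth_on_const smooth_on_bounded_linear bounded_linear_fst bounded_linear_snd) auto
  then have smooth: "smooth_map (open_mfd ?I) M (\<lambda>(s, \<theta>). (torus_action G t \<psi> \<circ> c) s \<theta>)"
    by (simp add: torus_action_apply case_prod_beta')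
  have "(torus_action G t \<psi> \<circ> c) s \<in> based_loops G M" if s: "s \<in> {-\<epsilon><..<\<epsilon>}" for s
  proof -
    have cs: "c s \<in> based_loops G M" using \<epsilon>(2) s by blast
    have "smooth_map (open_mfd UNIV) M ((torus_action G t \<psi> \<circ> c) s)"
      by (rule smooth_map_substitute[OF smooth smooth_on_const smooth_on_id]) (use s in auto)
    then show ?thesis
      using t based_loops_carrier[OF cs] based_loops_period'[OF cs]
      by (simp add: based_loops_def torus_action_apply)
  qed
  then show ?thesis unfolding loop_curve_at_def
    by (intro conjI exI[of _ \<epsilon>] ballI \<epsilon>(1) smooth) (simp_all add: \<epsilon>(4))
qed

text \<open>At a given angle the moved curve involves only the evaluations at
  \<open>\<theta> + \<psi>\<close> and at \<open>\<psi>\<close>. The product rule splits its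
  velocity into two terms, each the image of a single evaluation under a smooth map of
  \<open>G\<close>.\<close>

lemma loop_velocity_torus_action_cong:
  assumes t: "t \<in> carrier G" and c: "loop_curve_at G M \<gamma> c" and d: "loop_curve_at G M \<gamma> d"
    and eq: "loop_velocity M c = loop_velocity M d"
  shows "loop_velocity M (torus_action G t \<psi> \<circ> c) = loop_velocity M (torus_action G t \<psi> \<circ> d)"
proof (rule ext, rule ext)
  fix \<theta> \<kappa>
  \<comment> \<open>The values at parameter 0 of the two factors into which the moved curve is
    split.\<close>
  let ?p = "t \<otimes> \<gamma> (\<theta> + \<psi>)" and ?q = "inv (\<gamma> \<psi>) \<otimes> inv t"
  have pq: "?p \<in> carrier G" "?q \<in> carrier G"
    using t based_loops_carrier[OF loop_curve_at_based[OF c]] by auto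
  have left: "smooth_map M M (\<lambda>x. t \<otimes> x)" and left': "smooth_map M M (\<lambda>x. t \<otimes> x \<otimes> ?q)"
    and right: "smooth_map M M (\<lambda>x. inv x \<otimes> inv t)" and right': "smooth_map M M (\<lambda>x. ?p \<otimes> (inv x \<otimes> inv t))"
    using t pq by (intro smooth_map_group_intros; simp)+
  have split: "loop_velocity M (torus_action G t \<psi> \<circ> b) \<theta> \<kappa> =
      velocity M (\<lambda>s. t \<otimes> b s (\<theta> + \<psi>) \<otimes> ?q) \<kappa> + velocity M (\<lambda>s. ?p \<otimes> (inv (b s \<psi>) \<otimes> inv t)) \<kappa>"
    if b: "loop_curve_at G M \<gamma> b" for b
  proof -
    have prod: "velocity M (\<lambda>s. (torus_action G t \<psi> \<circ> b) s \<theta>) =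
        velocity M (\<lambda>s. (t \<otimes> b s (\<theta> + \<psi>)) \<otimes> (inv (b s \<psi>) \<otimes> inv t))"
    proof (rule velocity_cong)
      have "\<forall>\<^sub>F s in nhds 0. b s (\<theta> + \<psi>) \<in> carrier G" "\<forall>\<^sub>F s in nhds 0. b s \<psi> \<in> carrier G"
        by (rule smooth_curve_at_eventually_carrier[OF loop_curve_at_eval[OF b]])+
      then show "\<forall>\<^sub>F s in nhds 0. (torus_action G t \<psi> \<circ> b) s \<theta> =
          (t \<otimes> b s (\<theta> + \<psi>)) \<otimes> (inv (b s \<psi>) \<otimes> inv t)"
        by eventually_elim (simp add: torus_action_apply m_assoc t)
    qed
    have "velocity M (\<lambda>s. (t \<otimes> b s (\<theta> + \<psi>)) \<otimes> (inv (b s \<psi>) \<otimes> inv t)) \<kappa> =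
        velocity M (\<lambda>s. t \<otimes> b s (\<theta> + \<psi>) \<otimes> ?q) \<kappa>
        + velocity M (\<lambda>s. ?p \<otimes> (inv (b s \<psi>) \<otimes> inv t)) \<kappa>"
      by (rule smooth_curve_at_mult(2)[OF smooth_curve_at_compose[OF charted left loop_curve_at_eval[OF b]]
            smooth_curve_at_compose[OF charted right loop_curve_at_eval[OF b]]])
    then show ?thesis unfolding loop_velocity_def prod .
  qed
  have "velocity M (\<lambda>s. c s \<theta>) = velocity M (\<lambda>s. d s \<theta>)" for \<theta>
    using eq by (metis loop_velocity_def)
  then have "velocity M (\<lambda>s. t \<otimes> c s (\<theta> + \<psi>) \<otimes> ?q) = velocity M (\<lambda>s. t \<otimes> d s (\<theta> + \<psi>) \<otimes> ?q)"
    and "velocity M (\<lambda>s. ?p \<otimes> (inv (c s \<psi>) \<otimes> inv t)) = velocity M (\<lambda>s. ?p \<otimes> (inv (d s \<psi>) \<otimes> inv t))"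
    using velocity_compose_cong[OF charted charted left' loop_curve_at_eval[OF c] loop_curve_at_eval[OF d]]
      velocity_compose_cong[OF charted charted right' loop_curve_at_eval[OF c] loop_curve_at_eval[OF d]]
    by simp_all
  then show "loop_velocity M (torus_action G t \<psi> \<circ> c) \<theta> \<kappa> = loop_velocity M (torus_action G t \<psi> \<circ> d) \<theta> \<kappa>"
    by (simp add: split c d)
qed

text \<open>The curve chosen in the definition has the same velocity as \<open>c\<close>, so it may
  be replaced by \<open>c\<close>.\<close>

lemma loop_tangent_map_torus_action:
  assumes "t \<in> carrier G" "loop_curve_at G M \<gamma> c"
  shows "loop_tangent_map G M (torus_action G t \<psi>) \<gamma> (loop_velocity M c)
    = loop_velocity M (torus_action G t \<psi> \<circ> c)"
proof -
  let ?d = "SOME d. loop_curve_at G M \<gamma> d \<and> loop_velocity M d = loop_velocity M c"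
  have d: "loop_curve_at G M \<gamma> ?d \<and> loop_velocity M ?d = loop_velocity M c"
    by (rule someI[where x = c]) (use assms(2) in simp)
  show ?thesis unfolding loop_tangent_map_def
    by (rule loop_velocity_torus_action_cong[OF assms(1) _ assms(2)]) (use d in auto)
qed

lemma loop_differentiable_torus_action:
  assumes "t \<in> carrier G" shows "loop_differentiable_at G M (torus_action G t \<psi>) \<gamma>"
  unfolding loop_differentiable_at_def
  using loop_curve_at_torus_action[OF assms] loop_tangent_map_torus_action[OF assms] by simp

text \<open>Applied with \<open>u = \<gamma>(\<theta> + \<psi>)\<close>, \<open>v = \<gamma>(\<psi>)\<close>, \<open>x = c(\<theta> + \<psi>)\<close>, \<open>y = c(\<psi>)\<close>: the second factor on
  the right does not involve \<open>\<theta>\<close>.\<close>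

lemma fixed_loop_conj:
  assumes "t \<in> carrier G" "u \<in> carrier G" "v \<in> carrier G" "x \<in> carrier G" "y \<in> carrier G"
  shows "inv (t \<otimes> (u \<otimes> inv v) \<otimes> inv t) \<otimes> (t \<otimes> (x \<otimes> inv y) \<otimes> inv t) =
    ((t \<otimes> v) \<otimes> (inv u \<otimes> x) \<otimes> inv (t \<otimes> v)) \<otimes> ((t \<otimes> v) \<otimes> inv (inv v \<otimes> y) \<otimes> inv (t \<otimes> v))"
  using assms by (simp add: inv_mult_group m_assoc l_cancel_inv)

text \<open>The constant \<open>a\<close> arises from the factor \<open>inv (c s \<psi>)\<close>
  that rebases the rotated loop; through a curve \<open>c\<close> representing \<open>X\<close> it
  is the velocity of \<open>?B\<close>.\<close>

lemma isotropy_rep_formula: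
  assumes t: "t \<in> carrier G" and fixed: "torus_action G t \<psi> \<gamma> = \<gamma>"
    and \<gamma>: "\<gamma> \<in> based_loops G M" and X: "X \<in> based_algebra_loops G M"
  shows "isotropy_rep G M \<gamma> t \<psi> X \<in> based_algebra_loops G M"
    and "(\<lambda>\<theta>. Ad G M (t \<otimes> \<gamma> \<psi>) (X (\<theta> + \<psi>))) \<in> algebra_loops G M"
    and "\<exists>a\<in>lie_algebra G M. \<forall>\<theta> \<kappa>.
      isotropy_rep G M \<gamma> t \<psi> X \<theta> \<kappa> = Ad G M (t \<otimes> \<gamma> \<psi>) (X (\<theta> + \<psi>)) \<kappa> + a \<kappa>"
proof -
  let ?g = "t \<otimes> \<gamma> \<psi>"
  have \<gamma>_carrier: "\<gamma> \<theta> \<in> carrier G" for \<theta> by (rule based_loops_carrier[OF \<gamma>])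
  have g: "?g \<in> carrier G" using t \<gamma>_carrier by simp
  let ?\<delta> = "inv_into (loop_tangent_space G M \<gamma>) (left_triv G M \<gamma>) X"
  have X_image: "X \<in> left_triv G M \<gamma> ` loop_tangent_space G M \<gamma>"
    using X left_triv_bij_betw[OF \<gamma>] by (simp add: bij_betw_def)
  obtain c where c: "loop_curve_at G M \<gamma> c" "?\<delta> = loop_velocity M c"
    by (rule loop_tangent_spaceE[OF inv_into_into[OF X_image]])
  have "X = left_triv G M \<gamma> (loop_velocity M c)"
    using f_inv_into_f[OF X_image] c(2) by simp
  then have X_velocity: "X \<theta> = velocity M (\<lambda>s. inv (\<gamma> \<theta>) \<otimes> c s \<theta>)" for \<theta>
    using left_triv_velocity[OF c(1)] by simp
  let ?Fc = "torus_action G t \<psi> \<circ> c"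
  \<comment> \<open>Since \<open>\<gamma>\<close> is fixed, the moved curve starts at
    \<open>\<gamma>\<close> again, so its velocity can be trivialised at the same loop.\<close>
  have Fc: "loop_curve_at G M \<gamma> ?Fc"
    using loop_curve_at_torus_action[OF t c(1), of \<psi>] fixed by simp
  have rep: "isotropy_rep G M \<gamma> t \<psi> X = left_triv G M \<gamma> (loop_velocity M ?Fc)"
    by (simp add: isotropy_rep_def c(2) loop_tangent_map_torus_action[OF t c(1)])
  show "isotropy_rep G M \<gamma> t \<psi> X \<in> based_algebra_loops G M"
    unfolding rep by (rule left_triv_based[OF Fc])
  let ?A = "\<lambda>\<theta> s. ?g \<otimes> (inv (\<gamma> (\<theta> + \<psi>)) \<otimes> c s (\<theta> + \<psi>)) \<otimes> inv ?g"
  \<comment> \<open>The left translate of \<open>c\<close> at angle \<open>\<psi>\<close>, inverted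
    and conjugated: its velocity is minus the adjoint image of \<open>X \<psi>\<close> and is free
    of \<open>\<theta>\<close>.\<close>
  let ?B = "\<lambda>s. ?g \<otimes> inv (inv (\<gamma> \<psi>) \<otimes> c s \<psi>) \<otimes> inv ?g"
  have Ad_A: "Ad G M ?g (X (\<theta> + \<psi>)) = velocity M (?A \<theta>)" for \<theta>
    unfolding X_velocity by (rule Ad_velocity[OF g smooth_curve_at_left_triv[OF c(1)]])
  have A: "smooth_curve_at M \<one> (?A \<theta>)" for \<theta>
    by (rule smooth_curve_at_conj[OF g smooth_curve_at_left_triv[OF c(1)]])
  have "smooth_curve_at M \<one> (\<lambda>s. inv (inv (\<gamma> \<psi>) \<otimes> c s \<psi>))"
    using smooth_curve_at_inv[OF smooth_curve_at_left_triv[OF c(1), of \<psi>]] by simp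
  then have B: "smooth_curve_at M \<one> ?B" by (rule smooth_curve_at_conj[OF g])
  have "isotropy_rep G M \<gamma> t \<psi> X \<theta> \<kappa> = Ad G M ?g (X (\<theta> + \<psi>)) \<kappa> + velocity M ?B \<kappa>" for \<theta> \<kappa>
  proof -
    have "velocity M (\<lambda>s. inv (\<gamma> \<theta>) \<otimes> ?Fc s \<theta>) = velocity M (\<lambda>s. ?A \<theta> s \<otimes> ?B s)"
    proof (rule velocity_cong)
      have \<gamma>_eq: "\<gamma> \<theta> = t \<otimes> (\<gamma> (\<theta> + \<psi>) \<otimes> inv (\<gamma> \<psi>)) \<otimes> inv t"
        using fixed torus_action_apply by metis
      have "\<forall>\<^sub>F s in nhds 0. c s (\<theta> + \<psi>) \<in> carrier G" "\<forall>\<^sub>F s in nhds 0. c s \<psi> \<in> carrier G"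
        by (rule smooth_curve_at_eventually_carrier[OF loop_curve_at_eval[OF c(1)]])+
      then show "\<forall>\<^sub>F s in nhds 0. inv (\<gamma> \<theta>) \<otimes> ?Fc s \<theta> = ?A \<theta> s \<otimes> ?B s"
      proof eventually_elim
        case (elim s)
        have "inv (\<gamma> \<theta>) \<otimes> ?Fc s \<theta> = inv (t \<otimes> (\<gamma> (\<theta> + \<psi>) \<otimes> inv (\<gamma> \<psi>)) \<otimes> inv t) \<otimes> ?Fc s \<theta>"
          by (subst \<gamma>_eq) (rule refl)
        also have "\<dots> = ?A \<theta> s \<otimes> ?B s"
          unfolding o_apply torus_action_apply
          by (rule fixed_loop_conj[OF t \<gamma>_carrier \<gamma>_carrier elim])
        finally show ?case .
      qed
    qed
    then show ?thesis
      unfolding rep left_triv_velocity[OF Fc] Ad_A by (simp add: velocity_mult_one[OF A B])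
  qed
  then show "\<exists>a\<in>lie_algebra G M. \<forall>\<theta> \<kappa>.
      isotropy_rep G M \<gamma> t \<psi> X \<theta> \<kappa> = Ad G M ?g (X (\<theta> + \<psi>)) \<kappa> + a \<kappa>"
    using lie_algebraI[OF B] by blast
  obtain \<epsilon> where \<epsilon>: "\<epsilon> > 0" "\<forall>s\<in>{-\<epsilon><..<\<epsilon>}. c s \<in> based_loops G M"
    "smooth_map (open_mfd ({-\<epsilon><..<\<epsilon>} \<times> UNIV)) M (\<lambda>(s, \<theta>). c s \<theta>)" "c 0 = \<gamma>"
    by (rule loop_curve_atE[OF c(1)])
  have "(\<lambda>\<theta>. velocity M (\<lambda>s. ?A \<theta> s)) \<in> algebra_loops G M"
  proof (rule velocity_algebra_loops[OF \<epsilon>(1)])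
    have "smooth_map (open_mfd ({-\<epsilon><..<\<epsilon>} \<times> UNIV)) M
        (\<lambda>z. ?g \<otimes> (case z of (s, \<theta>) \<Rightarrow> inv (\<gamma> (\<theta> + \<psi>)) \<otimes> c s (\<theta> + \<psi>)) \<otimes> inv ?g)"
      by (intro smooth_map_mult[OF charted_open_mfd] smooth_map_element g inv_closed
          smooth_map_left_triv[OF \<gamma> \<epsilon>(3)])
    then show "smooth_map (open_mfd ({-\<epsilon><..<\<epsilon>} \<times> UNIV)) M (\<lambda>(s, \<theta>). ?A \<theta> s)"
      by (simp add: case_prod_beta')
    show "?A \<theta> 0 = \<one>" for \<theta> using g \<gamma>_carrier by (simp add: \<epsilon>(4))
    show "?A (\<theta> + 2 * pi) s = ?A \<theta> s" if "s \<in> {-\<epsilon><..<\<epsilon>}" for s \<theta>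
      using based_loops_period'[OF \<gamma>, of \<theta> \<psi>]
        based_loops_period'[OF \<epsilon>(2)[rule_format, OF that], of \<theta> \<psi>] by simp
  qed
  then show "(\<lambda>\<theta>. Ad G M ?g (X (\<theta> + \<psi>))) \<in> algebra_loops G M" by (simp add: Ad_A)
qed

text \<open>A constant difference is absorbed into the constant of the coset, in one direction by
  adding \<open>a\<close> and in the other by subtracting it.\<close>

lemma mod_constants_eqI:
  assumes a: "a \<in> lie_algebra G M" and eq: "\<And>\<theta> \<kappa>. X \<theta> \<kappa> = Y \<theta> \<kappa> + a \<kappa>"
  shows "mod_constants G M X = mod_constants G M Y"
proof -
  have "\<exists>b\<in>lie_algebra G M. \<forall>\<theta>. Z \<theta> = (\<lambda>\<kappa>. Y \<theta> \<kappa> + b \<kappa>)"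
    if "b \<in> lie_algebra G M" "\<forall>\<theta>. Z \<theta> = (\<lambda>\<kappa>. X \<theta> \<kappa> + b \<kappa>)" for Z :: "real \<Rightarrow> ('a, 'e) tangent" and b
    by (rule bexI[OF _ lie_algebra_add[OF a that(1)]]) (use that(2) eq in \<open>simp add: add.assoc\<close>)
  moreover have "\<exists>b\<in>lie_algebra G M. \<forall>\<theta>. Z \<theta> = (\<lambda>\<kappa>. X \<theta> \<kappa> + b \<kappa>)"
    if "b \<in> lie_algebra G M" "\<forall>\<theta>. Z \<theta> = (\<lambda>\<kappa>. Y \<theta> \<kappa> + b \<kappa>)" for Z :: "real \<Rightarrow> ('a, 'e) tangent" and b
    by (rule bexI[OF _ lie_algebra_add[OF that(1) lie_algebra_uminus[OF a]]]) (use that(2) eq in simp)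
  ultimately show ?thesis unfolding mod_constants_def by blast
qed

end

text \<open>The first two clauses certify the choices inside \<open>isotropy_rep\<close>:
  \<open>inv_into\<close> inverts a bijection, and the derivative of the action does not depend on
  the curve. The membership clauses ensure that the classes compared are those of actual smooth
  periodic loops, since \<open>mod_constants\<close> could be empty otherwise.\<close>

theorem proposition6:
  fixes G :: "('g, 'm) monoid_scheme" and M :: "('g, 'e::euclidean_space) mfd"
    and T :: "'g set" and \<gamma> :: "real \<Rightarrow> 'g" and t :: 'g and \<psi> :: real
  assumes "lie_group G M" and "compact_space (mtop M)" and "connected_space (mtop M)"
    and "maximal_torus G M T"
    and "\<gamma> \<in> based_loops G M" and "fixed_loop G T \<gamma>"
    and "t \<in> T"
  shows "bij_betw (left_triv G M \<gamma>) (loop_tangent_space G M \<gamma>) (based_algebra_loops G M)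
    \<and> loop_differentiable_at G M (torus_action G t \<psi>) \<gamma>
    \<and> (\<forall>X\<in>based_algebra_loops G M.
         isotropy_rep G M \<gamma> t \<psi> X \<in> based_algebra_loops G M \<and>
         (\<lambda>\<theta>. Ad G M (t \<otimes>\<^bsub>G\<^esub> \<gamma> \<psi>) (X (\<theta> + \<psi>))) \<in> algebra_loops G M \<and>
         mod_constants G M (isotropy_rep G M \<gamma> t \<psi> X) =
         mod_constants G M (\<lambda>\<theta>. Ad G M (t \<otimes>\<^bsub>G\<^esub> \<gamma> \<psi>) (X (\<theta> + \<psi>))))"
proof -
  interpret group G using assms(1) by (simp add: lie_group_def)
  interpret lie_group_mfd G M by unfold_locales (rule assms(1))
  have t: "t \<in> carrier G"
    using assms(4,7) subgroup.subset by (fastforce simp: maximal_torus_def torus_subgroup_def)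
  have fixed: "torus_action G t \<psi> \<gamma> = \<gamma>"
    using assms(6,7) by (simp add: fixed_loop_def)
  show ?thesis
  proof (intro conjI ballI)
    show "bij_betw (left_triv G M \<gamma>) (loop_tangent_space G M \<gamma>) (based_algebra_loops G M)"
      by (rule left_triv_bij_betw[OF assms(5)])
    show "loop_differentiable_at G M (torus_action G t \<psi>) \<gamma>"
      by (rule loop_differentiable_torus_action[OF t])
    fix X assume X: "X \<in> based_algebra_loops G M"
    note rep = isotropy_rep_formula[OF t fixed assms(5) X]
    show "isotropy_rep G M \<gamma> t \<psi> X \<in> based_algebra_loops G M" by (rule rep(1))
    show "(\<lambda>\<theta>. Ad G M (t \<otimes>\<^bsub>G\<^esub> \<gamma> \<psi>) (X (\<theta> + \<psi>))) \<in> algebra_loops G M" by (rule rep(2))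
    obtain a where "a \<in> lie_algebra G M" "\<forall>\<theta> \<kappa>.
        isotropy_rep G M \<gamma> t \<psi> X \<theta> \<kappa> = Ad G M (t \<otimes>\<^bsub>G\<^esub> \<gamma> \<psi>) (X (\<theta> + \<psi>)) \<kappa> + a \<kappa>"
      using rep(3) by blast
    then show "mod_constants G M (isotropy_rep G M \<gamma> t \<psi> X) =
        mod_constants G M (\<lambda>\<theta>. Ad G M (t \<otimes>\<^bsub>G\<^esub> \<gamma> \<psi>) (X (\<theta> + \<psi>)))"
      by (intro mod_constants_eqI) auto
  qed
qed

end
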